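(* There exists a deterministic constant $\kappa$ such that, almost surely, there is $T=T(\omega)>0$ for which $$\left|u_t(x)-W\left(1-\frac{x}{\alpha}\right)\right|\le\kappa\sqrt{-\left(\frac{x}{t}\right)^{1/2}\log\left(\frac{x}{t}\right)}$$ for all $t\ge T$ and all $x\in(0,\alpha]$ satisfying $x>\alpha L_t^x$. In particular, for any fixed $\beta\in(0,1)$, almost surely there is $T$ such that the inequality $$\left|u_t(x)-W\left(1-\frac{x}{\alpha}\right)\right|\le\kappa\sqrt{-\left(\frac{x}{t}\right)^{1/2}\log\left(\frac{x}{t}\right)}$$ holds for all $x\in[t^{-\beta},\alpha]$ and all $t\ge T$. Furthermore, $\kappa$ can be chosen so that the following holds for sufficiently large $t$: $$P\left(\left|u_t(x)-W\left(1-\frac{x}{\alpha}\right)\right|>\kappa\sqrt{-\left(\frac{x}{t}\right)^{1/2}\log\left(\frac{x}{t}\right)}\ \text{ for some }x\in[t^{-\beta},\alpha]\right)\le t^{-2}.$$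
   Context: Fix $\alpha\in(0,1)$, $\sigma=\sqrt{\alpha(1-\alpha)}$ and $\sigma_t=\sigma/\sqrt t$. Let $W$ be a standard two-dimensional Brownian motion on $[0,1]$ (the same $W$ is used for all $t$). The scaled two-dimensional Conga line at time $t$ is $$u_t(x)=\int_0^1W(1-z)\frac{1}{\sqrt{2\pi}}\,\frac{x+\alpha z}{2\sigma_t z^{3/2}}\exp\left(-\frac{(x-\alpha z)^2}{2\sigma_t^2z}\right)dz,\qquad 0<x\le 1 .$$ $L_t^x=\alpha^{-1}\sqrt{-M\sigma_t^2x\log(\sigma_t^2x)}$, where $M>2$ is a fixed constant. $|\cdot|$ is the Euclidean norm. *)

theory Defs
  imports "HOL-Probability.Probability"
begin

(* Paths are only required to be almost surely continuous, and only the values on [0,1] matter. *)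
definition std_brownian_motion_1d :: "'w measure \<Rightarrow> (real \<Rightarrow> 'w \<Rightarrow> real) \<Rightarrow> bool" where
  "std_brownian_motion_1d P B \<longleftrightarrow>
     (\<forall>s\<in>{0..1}. B s \<in> borel_measurable P) \<and>
     (AE \<omega> in P. B 0 \<omega> = 0) \<and>
     (\<forall>s t. 0 \<le> s \<and> s < t \<and> t \<le> 1 \<longrightarrow>
        distributed P lborel (\<lambda>\<omega>. B t \<omega> - B s \<omega>) (normal_density 0 (sqrt (t - s)))) \<and>
     (\<forall>n (\<tau> :: nat \<Rightarrow> real). mono_on {..n} \<tau> \<and> \<tau> ` {..n} \<subseteq> {0..1} \<longrightarrow>
        prob_space.indep_vars P (\<lambda>_. borel) (\<lambda>i \<omega>. B (\<tau> (Suc i)) \<omega> - B (\<tau> i) \<omega>) {..<n}) \<and>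
     (AE \<omega> in P. continuous_on {0..1} (\<lambda>s. B s \<omega>))"

(* The coordinate processes are independent as random elements of the path space R^[0,1]. *)
definition std_brownian_motion ::
    "'w measure \<Rightarrow> (real \<Rightarrow> 'w \<Rightarrow> real ^ 'd :: finite) \<Rightarrow> bool" where
  "std_brownian_motion P W \<longleftrightarrow>
     (\<forall>i. std_brownian_motion_1d P (\<lambda>s \<omega>. W s \<omega> $ i)) \<and>
     prob_space.indep_vars P (\<lambda>_. PiM {0..1} (\<lambda>_. borel))
       (\<lambda>i \<omega>. \<lambda>s\<in>{0..1}. W s \<omega> $ i) UNIV"

definition conga_sigma :: "real \<Rightarrow> real \<Rightarrow> real" where
  "conga_sigma \<alpha> t = sqrt (\<alpha> * (1 - \<alpha>)) / sqrt t"

(* The argument w is one path of the driving process. *)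
definition conga_line :: "real \<Rightarrow> (real \<Rightarrow> real ^ 'd :: finite) \<Rightarrow> real \<Rightarrow> real \<Rightarrow> real ^ 'd" where
  "conga_line \<alpha> w t x =
     (LBINT z:{0..1}.
        (1 / sqrt (2 * pi) * ((x + \<alpha> * z) / (2 * conga_sigma \<alpha> t * z powr (3/2)))
          * exp (- ((x - \<alpha> * z)\<^sup>2 / (2 * (conga_sigma \<alpha> t)\<^sup>2 * z)))) *\<^sub>R w (1 - z))"

definition conga_L :: "real \<Rightarrow> real \<Rightarrow> real \<Rightarrow> real \<Rightarrow> real" where
  "conga_L \<alpha> M t x =
     (1 / \<alpha>) * sqrt (- (M * (conga_sigma \<alpha> t)\<^sup>2 * x * ln ((conga_sigma \<alpha> t)\<^sup>2 * x)))"

definition conga_rate :: "real \<Rightarrow> real \<Rightarrow> real" where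
  "conga_rate t x = sqrt (- ((x / t) powr (1/2) * ln (x / t)))"

end

theory Submission
  imports Defs
begin

text \<open>
  The deviation \<open>u\<^sub>t(x) - W(1 - x/\<alpha>)\<close> is controlled path by path through the modulus of continuity
  of \<open>W\<close>; chance enters only in showing that the modulus holds.

  Put \<open>y(z) = (\<alpha> z - x) / (\<sigma>\<^sub>t sqrt z)\<close>. Then the kernel of the Conga line is exactly \<open>\<phi>(y(z)) y'(z)\<close>, with
  \<open>\<phi>\<close> the standard normal density, and \<open>y\<close> maps \<open>(0, \<infinity>)\<close> bijectively onto the real line. If the path is
  continued by \<open>W(s) = W(0) = 0\<close> for \<open>s < 0\<close>, the integral over \<open>[0,1]\<close> becomes an integral over
  \<open>(0, \<infinity>)\<close> with total mass one, so \<open>u\<^sub>t(x)\<close> is an average of \<open>W(1 - z)\<close> over a standard normal \<open>y\<close>; this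
  covers also \<open>x\<close> near \<open>\<alpha>\<close>, where a sizeable part of the mass sits at \<open>z > 1\<close>. Solving for \<open>z\<close> gives
  \<open>\<bar>z - x/\<alpha>\<bar> \<le> C sqrt(x/t) (1 + y\<^sup>2)\<close> as soon as \<open>x t\<close> is bounded below, so the natural scale of the
  averaging is \<open>\<delta> = sqrt(x/t)\<close>. If increments of the path over lengths at most \<open>\<delta>\<close> are bounded by \<open>A\<close>,
  then an increment over a length \<open>h\<close> is at most \<open>A (h/\<delta> + 1)\<close>, and averaging \<open>1 + y\<^sup>2\<close> bounds the
  deviation by a constant times \<open>A\<close> (\<open>conga_line_approximation\<close>).

  Levy's modulus supplies \<open>A\<close> of order \<open>sqrt(\<delta> log(1/\<delta>))\<close>, which is the asserted rate up to a constant.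
  A union bound over the dyadic increments gives probability at most \<open>C 32\<^sup>-\<^sup>m\<close> to its failure at some scale
  below \<open>2\<^sup>-\<^sup>m\<close> (\<open>bm_dyadic_good_prob\<close>), and chaining passes from dyadic to arbitrary increments
  (\<open>dyadic_good_modulus\<close>). All \<open>x \<le> \<alpha>\<close> have \<open>\<delta> \<le> 1/sqrt t\<close>; hence almost surely the bound holds for
  all large \<open>t\<close>, and with \<open>2\<^sup>-\<^sup>m\<close> of order \<open>1/sqrt t\<close> the failure probability at time \<open>t\<close> is of order
  \<open>t\<^sup>-\<^sup>5\<^sup>/\<^sup>2\<close>, below \<open>t\<^sup>-\<^sup>2\<close>. For large \<open>t\<close> both regions of \<open>x\<close> in the theorem keep \<open>x t \<ge> \<alpha> (1 - \<alpha>)\<close>, so that one \<open>\<kappa>\<close>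
  serves them all.

  That the exceptional event belongs to the completed \<open>\<sigma>\<close>-algebra is a separate matter: off a null set the
  deviation is continuous in \<open>x\<close>, so the supremum can be taken over a countable dense set.
\<close>

section \<open>Moduli of continuity\<close>

text \<open>Each point is approached through its dyadic predecessors, and passing from one level to the next costs
  at most one dyadic increment. The decay \<open>9 l\<^sub>n\<^sub>+\<^sub>1 \<le> 8 l\<^sub>n\<close> lets the costs telescope to \<open>8 l\<^sub>n\<close> for each
  end point, and one further increment joins the two predecessors.\<close>

lemma dyadic_chaining:
  fixes f :: "real \<Rightarrow> 'b::real_normed_vector" and l :: "nat \<Rightarrow> real"
  assumes cont: "continuous_on {0..1} f"
    and incr: "\<And>n k. m \<le> n \<Longrightarrow> k < 2 ^ n \<Longrightarrow>
      norm (f (real (Suc k) / 2 ^ n) - f (real k / 2 ^ n)) \<le> l n"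
    and decay: "\<And>n. m \<le> n \<Longrightarrow> 9 * l (Suc n) \<le> 8 * l n"
    and "m \<le> n" and a: "a \<in> {0..1}" and b: "b \<in> {0..1}" and ab: "\<bar>a - b\<bar> \<le> 1 / 2 ^ n"
  shows "norm (f a - f b) \<le> 17 * l n"
proof -
  define p :: "real \<Rightarrow> nat \<Rightarrow> nat" where "p s N = nat \<lfloor>s * 2 ^ N\<rfloor>" for s N
  define d where "d s N = f (real (p s N) / 2 ^ N)" for s N
  have p_floor: "int (p s N) = \<lfloor>s * 2 ^ N\<rfloor>" if "s \<in> {0..1}" for s N
    using that by (simp add: p_def)
  have p_le: "p s N \<le> 2 ^ N" if "s \<in> {0..1}" for s N
  proof -
    have "s * 2 ^ N \<le> 2 ^ N" using that by simp
    hence "real (p s N) \<le> 2 ^ N" using p_floor[OF that, of N] by linarith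
    thus ?thesis by simp
  qed
  have l_nonneg: "0 \<le> l N" if "m \<le> N" for N
    using incr[OF that, of 0] norm_ge_zero order_trans by (metis zero_less_numeral zero_less_power)
  have step: "norm (f (real i / 2 ^ N) - f (real j / 2 ^ N)) \<le> l N"
    if "m \<le> N" "i \<le> 2 ^ N" "j \<le> 2 ^ N" "i \<le> Suc j" "j \<le> Suc i" for i j N
  proof -
    have "i = j \<or> i = Suc j \<or> j = Suc i" using that by arith
    then consider "i = j" | "i = Suc j" | "j = Suc i" by blast
    thus ?thesis
    proof cases
      case 1 thus ?thesis using l_nonneg that by simp
    next
      case 2 thus ?thesis using incr[of N j] that by simp
    next
      case 3 thus ?thesis using incr[of N i] that by (simp add: norm_minus_commute)
    qed
  qed
  have refine: "norm (d s (Suc N) - d s N) \<le> l (Suc N)" if s: "s \<in> {0..1}" and N: "m \<le> N" for s N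
  proof -
    have e: "real (p s N) / 2 ^ N = real (2 * p s N) / 2 ^ Suc N" by simp
    have fl: "s * 2 ^ Suc N = 2 * (s * 2 ^ N)" by simp
    have "\<lfloor>2 * (s * 2 ^ N)\<rfloor> \<le> 2 * \<lfloor>s * 2 ^ N\<rfloor> + 1" "2 * \<lfloor>s * 2 ^ N\<rfloor> \<le> \<lfloor>2 * (s * 2 ^ N)\<rfloor>" by linarith+
    hence "p s (Suc N) \<le> Suc (2 * p s N)" "2 * p s N \<le> p s (Suc N)"
      using p_floor[OF s, of N] p_floor[OF s, of "Suc N"] unfolding fl by linarith+
    moreover have "2 * p s N \<le> 2 ^ Suc N" using p_le[OF s, of N] by simp
    ultimately show ?thesis unfolding d_def e using N p_le[OF s, of "Suc N"] by (intro step) auto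
  qed
  \<comment> \<open>By the decay, each new increment is paid for by the decrease of \<open>8 * l\<close>.\<close>
  have tele: "norm (d s (n + i) - d s n) \<le> 8 * (l n - l (n + i))" if s: "s \<in> {0..1}" for s i
  proof (induction i)
    case 0 show ?case by simp
  next
    case (Suc i)
    have "norm (d s (n + Suc i) - d s n) \<le> norm (d s (Suc (n + i)) - d s (n + i)) + norm (d s (n + i) - d s n)"
      using dist_triangle[of "d s (n + Suc i)" "d s n" "d s (n + i)"] by (simp add: dist_norm)
    also have "\<dots> \<le> l (Suc (n + i)) + 8 * (l n - l (n + i))"
      using refine[OF s, of "n + i"] Suc \<open>m \<le> n\<close> by simp
    also have "\<dots> \<le> 8 * (l n - l (n + Suc i))"
      using decay[of "n + i"] \<open>m \<le> n\<close> by simp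
    finally show ?case .
  qed
  have lim: "norm (f s - d s n) \<le> 8 * l n" if s: "s \<in> {0..1}" for s
  proof -
    have "(\<lambda>i. real (p s (n + i)) / 2 ^ (n + i)) \<longlonglongrightarrow> s"
    proof (rule tendsto_sandwich)
      have *: "real (p s N) \<le> s * 2 ^ N" "s * 2 ^ N - 1 \<le> real (p s N)" for N
        using p_floor[OF s, of N] by linarith+
      show "\<forall>\<^sub>F i in sequentially. real (p s (n + i)) / 2 ^ (n + i) \<le> s"
        using *(1)[of "n + _"] by (simp add: field_simps)
      have "s - (1/2) ^ N \<le> real (p s N) / 2 ^ N" for N
      proof -
        have "s - (1/2) ^ N = (s * 2 ^ N - 1) / 2 ^ N" by (simp add: diff_divide_distrib power_divide)
        thus ?thesis using *(2)[of N] by (simp add: divide_right_mono)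
      qed
      thus "\<forall>\<^sub>F i in sequentially. s - (1/2) ^ (n + i) \<le> real (p s (n + i)) / 2 ^ (n + i)" by simp
      have "(\<lambda>i. (1/2::real) ^ (i + n)) \<longlonglongrightarrow> 0"
        by (intro LIMSEQ_ignore_initial_segment LIMSEQ_power_zero) simp
      thus "(\<lambda>i. s - (1/2) ^ (n + i)) \<longlonglongrightarrow> s"
        using tendsto_diff[OF tendsto_const, of _ 0 sequentially s] by (simp add: add.commute)
    qed simp
    moreover have "\<forall>\<^sub>F i in sequentially. real (p s (n + i)) / 2 ^ (n + i) \<in> {0..1}"
    proof -
      have "real (p s N) / 2 ^ N \<le> 1" for N
        using p_le[OF s, of N] by (simp add: divide_le_eq numeral_power_le_of_nat_cancel_iff of_nat_le_numeral_power_cancel_iff)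
      thus ?thesis by simp
    qed
    ultimately have "(\<lambda>i. d s (n + i)) \<longlonglongrightarrow> f s"
      unfolding d_def using continuous_on_tendsto_compose[OF cont _ s] by blast
    hence "(\<lambda>i. norm (d s (n + i) - d s n)) \<longlonglongrightarrow> norm (f s - d s n)" by (intro tendsto_intros)
    thus ?thesis
    proof (rule LIMSEQ_le_const2, intro exI allI impI)
      show "norm (d s (n + i) - d s n) \<le> 8 * l n" for i
        using tele[OF s, of i] l_nonneg[of "n + i"] \<open>m \<le> n\<close> by simp
    qed
  qed
  have "a * 2 ^ n \<le> b * 2 ^ n + 1" "b * 2 ^ n \<le> a * 2 ^ n + 1"
    using ab by (simp_all add: field_simps abs_le_iff)
  hence "\<lfloor>a * 2 ^ n\<rfloor> \<le> \<lfloor>b * 2 ^ n\<rfloor> + 1" "\<lfloor>b * 2 ^ n\<rfloor> \<le> \<lfloor>a * 2 ^ n\<rfloor> + 1" by linarith+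
  hence "p a n \<le> Suc (p b n)" "p b n \<le> Suc (p a n)"
    using p_floor[OF a, of n] p_floor[OF b, of n] by linarith+
  hence "norm (d a n - d b n) \<le> l n"
    unfolding d_def using p_le a b \<open>m \<le> n\<close> by (intro step) auto
  moreover have "norm (f a - f b) \<le> norm (f a - d a n) + norm (d a n - d b n) + norm (d b n - f b)"
    using dist_triangle[of "f a" "f b" "d a n"] dist_triangle[of "d a n" "f b" "d b n"]
    by (simp add: dist_norm)
  ultimately show ?thesis using lim[OF a] lim[OF b] by (simp add: norm_minus_commute)
qed

text \<open>An increment over a long interval is split into steps of length at most \<open>d\<close>.\<close>

lemma norm_diff_le_steps:
  fixes f :: "real \<Rightarrow> 'b::real_normed_vector"
  assumes mod: "\<And>a b. a \<in> {0..1} \<Longrightarrow> b \<in> {0..1} \<Longrightarrow> \<bar>a - b\<bar> \<le> d \<Longrightarrow> norm (f a - f b) \<le> A"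
    and "0 < d" and a: "a \<in> {0..1}" and b: "b \<in> {0..1}"
  shows "norm (f a - f b) \<le> A * (\<bar>a - b\<bar> / d + 1)"
proof -
  have "0 \<le> A" using mod[of 0 0] \<open>0 < d\<close> by simp
  have count: "norm (f a - f b) \<le> A * real n"
    if "a \<in> {0..1}" "b \<in> {0..1}" "\<bar>a - b\<bar> \<le> real n * d" for n a b
    using that
  proof (induction n arbitrary: b)
    case 0 thus ?case by simp
  next
    case (Suc n)
    \<comment> \<open>The point one step short of \<open>b\<close>, when \<open>[a, b]\<close> is divided into \<open>n + 1\<close> equal steps.\<close>
    define c where "c = a + (b - a) * (real n / real (Suc n))"
    have c': "c = (1 - real n / real (Suc n)) * a + (real n / real (Suc n)) * b"
      unfolding c_def by algebra
    have "c \<in> {0..1}"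
      unfolding c' using Suc.prems(1,2)
        convexD[OF convex_real_interval(5), of a 0 1 b "1 - real n / real (Suc n)" "real n / real (Suc n)"]
      by simp
    have e: "a - c = (a - b) * (real n / real (Suc n))" unfolding c_def by algebra
    have e2: "c - b = (a - b) / real (Suc n)" by (simp add: c_def field_simps)
    have "\<bar>a - c\<bar> = \<bar>a - b\<bar> * (real n / real (Suc n))" unfolding e by (simp add: abs_mult)
    also have "\<dots> \<le> (real (Suc n) * d) * (real n / real (Suc n))"
      using Suc.prems by (intro mult_right_mono) auto
    also have "\<dots> = real n * d" by simp
    finally have 1: "\<bar>a - c\<bar> \<le> real n * d" .
    have "\<bar>c - b\<bar> \<le> d" unfolding e2 using Suc.prems(3) by (simp add: field_simps)
    hence "norm (f c - f b) \<le> A" using mod \<open>c \<in> {0..1}\<close> Suc.prems by blast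
    moreover have "norm (f a - f c) \<le> A * real n" using Suc.IH[OF Suc.prems(1) \<open>c \<in> {0..1}\<close> 1] .
    moreover have "norm (f a - f b) \<le> norm (f a - f c) + norm (f c - f b)"
      using dist_triangle[of "f a" "f b" "f c"] by (simp add: dist_norm)
    ultimately show ?case by (simp add: algebra_simps)
  qed
  define n where "n = nat \<lceil>\<bar>a - b\<bar> / d\<rceil>"
  have n: "\<bar>a - b\<bar> / d \<le> real n" "real n \<le> \<bar>a - b\<bar> / d + 1"
    using \<open>0 < d\<close> by (auto simp: n_def of_nat_nat)
  have "norm (f a - f b) \<le> A * real n"
    using n(1) \<open>0 < d\<close> by (intro count a b) (simp add: field_simps)
  also have "\<dots> \<le> A * (\<bar>a - b\<bar> / d + 1)" using n(2) \<open>0 \<le> A\<close> by (rule mult_left_mono)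
  finally show ?thesis .
qed

section \<open>Levy's modulus for Brownian motion\<close>

text \<open>On \<open>\<bar>x\<bar> > c\<close> half of the Gaussian exponent is at least \<open>c\<^sup>2 / (4 \<sigma>\<^sup>2)\<close>; the other half is the exponent of a
  normal density with twice the variance, which integrates to one.\<close>

lemma normal_tail_bound:
  assumes "prob_space M" and D: "distributed M lborel X (normal_density 0 \<sigma>)"
    and "0 < \<sigma>" and "0 \<le> c"
  shows "measure M {\<omega> \<in> space M. c < \<bar>X \<omega>\<bar>} \<le> sqrt 2 * exp (- c\<^sup>2 / (4 * \<sigma>\<^sup>2))"
proof -
  interpret prob_space M by fact
  let ?e = "sqrt 2 * exp (- c\<^sup>2 / (4 * \<sigma>\<^sup>2))"
  have dens: "normal_density 0 \<sigma> x \<le> ?e * normal_density 0 (sqrt 2 * \<sigma>) x" if "c < \<bar>x\<bar>" for x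
  proof -
    have "c\<^sup>2 \<le> x\<^sup>2" using that \<open>0 \<le> c\<close> by (metis abs_le_square_iff abs_of_nonneg less_imp_le)
    hence "exp (- (x\<^sup>2 / (4 * \<sigma>\<^sup>2))) \<le> exp (- (c\<^sup>2 / (4 * \<sigma>\<^sup>2)))"
      using \<open>0 < \<sigma>\<close> by (simp add: divide_right_mono)
    hence "exp (- (x\<^sup>2 / (4 * \<sigma>\<^sup>2))) * exp (- (x\<^sup>2 / (4 * \<sigma>\<^sup>2)))
       \<le> exp (- (c\<^sup>2 / (4 * \<sigma>\<^sup>2))) * exp (- (x\<^sup>2 / (4 * \<sigma>\<^sup>2)))" by (rule mult_right_mono) simp
    hence "exp (- (x\<^sup>2 / (2 * \<sigma>\<^sup>2))) \<le> exp (- (c\<^sup>2 / (4 * \<sigma>\<^sup>2))) * exp (- (x\<^sup>2 / (4 * \<sigma>\<^sup>2)))"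
      by (simp flip: exp_add)
    moreover have "normal_density 0 \<sigma> x = exp (- (x\<^sup>2 / (2 * \<sigma>\<^sup>2))) / (sqrt 2 * sqrt pi * \<sigma>)"
      using \<open>0 < \<sigma>\<close> by (simp add: normal_density_def real_sqrt_mult)
    moreover have "?e * normal_density 0 (sqrt 2 * \<sigma>) x
        = exp (- (c\<^sup>2 / (4 * \<sigma>\<^sup>2))) * exp (- (x\<^sup>2 / (4 * \<sigma>\<^sup>2))) / (sqrt 2 * sqrt pi * \<sigma>)"
      using \<open>0 < \<sigma>\<close> real_sqrt_mult_self[of 2]
      by (simp add: normal_density_def power_mult_distrib real_sqrt_mult field_simps del: real_sqrt_mult_self)
    ultimately show ?thesis using \<open>0 < \<sigma>\<close> by (simp add: divide_right_mono)
  qed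
  have "{\<omega> \<in> space M. c < \<bar>X \<omega>\<bar>} = X -` {x. c < \<bar>x\<bar>} \<inter> space M" by auto
  hence "emeasure M {\<omega> \<in> space M. c < \<bar>X \<omega>\<bar>}
      = (\<integral>\<^sup>+x. ennreal (normal_density 0 \<sigma> x) * indicator {x. c < \<bar>x\<bar>} x \<partial>lborel)"
    using distributed_emeasure[OF D, of "{x. c < \<bar>x\<bar>}"] by simp
  also have "\<dots> \<le> (\<integral>\<^sup>+x. ennreal ?e * ennreal (normal_density 0 (sqrt 2 * \<sigma>) x) \<partial>lborel)"
    using dens by (intro nn_integral_mono) (auto simp: indicator_def simp flip: ennreal_mult intro!: ennreal_leI)
  also have "\<dots> = ennreal ?e * (\<integral>\<^sup>+x. ennreal (normal_density 0 (sqrt 2 * \<sigma>) x) \<partial>lborel)"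
    by (intro nn_integral_cmult) simp
  also have "(\<integral>\<^sup>+x. ennreal (normal_density 0 (sqrt 2 * \<sigma>) x) \<partial>lborel) = 1"
    using \<open>0 < \<sigma>\<close> by (subst nn_integral_eq_integral) auto
  finally show ?thesis by (simp add: emeasure_eq_measure)
qed

text \<open>Levy's modulus along dyadic increments of length at most \<open>2\<^sup>-\<^sup>m\<close>. The factor 24 makes one Gaussian increment
  of level \<open>n\<close> fail with probability of order \<open>64\<^sup>-\<^sup>n\<close>, which leaves \<open>32\<^sup>-\<^sup>n\<close> after a union bound over the
  \<open>2\<^sup>n\<close> intervals. Coordinates are bounded separately, so that only one-dimensional Gaussian tails occur.\<close>

definition dyadic_good :: "nat \<Rightarrow> (real \<Rightarrow> real ^ 'd::finite) \<Rightarrow> bool" where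
  "dyadic_good m w \<longleftrightarrow> (\<forall>n\<ge>m. \<forall>k<2 ^ n. \<forall>i.
     \<bar>w (real (Suc k) / 2 ^ n) $ i - w (real k / 2 ^ n) $ i\<bar> \<le> sqrt (24 * real n / 2 ^ n))"

text \<open>Chaining at the level \<open>n\<close> with \<open>d \<le> 2\<^sup>-\<^sup>n \<le> 2 d\<close>. The ratio of successive levels is
  \<open>sqrt((n + 1) / (2 n))\<close>, which is below \<open>8/9\<close> from \<open>n = 2\<close> on.\<close>

lemma dyadic_good_modulus:
  fixes w :: "real \<Rightarrow> real ^ 'd::finite"
  assumes good: "dyadic_good m w" and "2 \<le> m" and cont: "continuous_on {0..1} w"
    and d: "0 < d" "d \<le> 1 / 2 ^ m"
    and ab: "a \<in> {0..1}" "b \<in> {0..1}" "\<bar>a - b\<bar> \<le> d"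
  shows "norm (w a - w b) \<le> 150 * real CARD('d) * sqrt (d * ln (1 / d))"
proof -
  define l where "l n = real CARD('d) * sqrt (24 * real n / 2 ^ n)" for n
  define n where "n = nat \<lfloor>log 2 (1 / d)\<rfloor>"
  have "2 ^ m \<le> 1 / d" using d by (simp add: field_simps)
  hence lg: "real m \<le> log 2 (1 / d)"
    using d by (simp add: le_log_iff powr_realpow)
  hence n: "m \<le> n" "real n \<le> log 2 (1 / d)" "log 2 (1 / d) < real n + 1"
    unfolding n_def by (simp_all add: le_nat_floor)
  have "2 powr real n \<le> 1 / d" using n(2) d by (simp add: le_log_iff)
  hence dn: "d \<le> 1 / 2 ^ n" using d by (simp add: powr_realpow field_simps)
  have "1 / d < 2 powr (real n + 1)" using n(3) d by (simp add: log_less_iff)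
  hence nd: "1 / 2 ^ n \<le> 2 * d" using d by (simp add: powr_add powr_realpow field_simps)
  have "norm (w a - w b) \<le> 17 * l n"
  proof (rule dyadic_chaining[OF cont _ _ n(1) ab(1,2)])
    show "\<bar>a - b\<bar> \<le> 1 / 2 ^ n" using ab dn by linarith
    show "norm (w (real (Suc k) / 2 ^ j) - w (real k / 2 ^ j)) \<le> l j" if "m \<le> j" "k < 2 ^ j" for j k
    proof -
      have "norm (w (real (Suc k) / 2 ^ j) - w (real k / 2 ^ j))
          \<le> (\<Sum>i\<in>UNIV. \<bar>(w (real (Suc k) / 2 ^ j) - w (real k / 2 ^ j)) $ i\<bar>)"
        by (rule norm_le_l1_cart)
      also have "\<dots> \<le> (\<Sum>i\<in>(UNIV :: 'd set). sqrt (24 * real j / 2 ^ j))"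
        using good that by (intro sum_mono) (simp add: dyadic_good_def)
      finally show ?thesis by (simp add: l_def)
    qed
    show "9 * l (Suc j) \<le> 8 * l j" if "m \<le> j" for j
    proof -
      have "81 * (24 * real (Suc j) / 2 ^ Suc j) \<le> 64 * (24 * real j / 2 ^ j)"
        using that \<open>2 \<le> m\<close> by (simp add: field_simps)
      hence "sqrt (81 * (24 * real (Suc j) / 2 ^ Suc j)) \<le> sqrt (64 * (24 * real j / 2 ^ j))"
        by (rule real_sqrt_le_mono)
      moreover have "sqrt 81 = (9::real)" "sqrt 64 = (8::real)" by (rule real_sqrt_unique; simp)+
      ultimately have "9 * sqrt (24 * real (Suc j) / 2 ^ Suc j) \<le> 8 * sqrt (24 * real j / 2 ^ j)"
        unfolding real_sqrt_mult by simp
      hence "real CARD('d) * (9 * sqrt (24 * real (Suc j) / 2 ^ Suc j))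
          \<le> real CARD('d) * (8 * sqrt (24 * real j / 2 ^ j))" by (rule mult_left_mono) simp
      thus ?thesis by (simp add: l_def mult_ac)
    qed
  qed
  \<comment> \<open>Here \<open>24 / ln 2 \<le> 36\<close> doubles to 72 because \<open>2\<^sup>-\<^sup>n \<le> 2 d\<close>, and \<open>17 sqrt 72 < 150\<close>.\<close>
  also have "17 * l n \<le> 150 * real CARD('d) * sqrt (d * ln (1 / d))"
  proof -
    have "1 / 2 ^ m < (1::real)" using \<open>2 \<le> m\<close> by simp
    hence "d < 1" using d by linarith
    hence ln0: "0 \<le> ln (1 / d)" using d by simp
    have "24 * real n / 2 ^ n = 24 * real n * (1 / 2 ^ n)" by simp
    also have "\<dots> \<le> 24 * log 2 (1 / d) * (2 * d)"
      using n nd d \<open>d < 1\<close> by (intro mult_mono) auto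
    also have "\<dots> = 48 * (d * ln (1 / d)) / ln 2" by (simp add: log_def)
    also have "\<dots> \<le> 48 * (d * ln (1 / d)) / (2 / 3)"
    proof (rule divide_left_mono[OF ln2_ge_two_thirds])
      show "0 \<le> 48 * (d * ln (1 / d))" using mult_nonneg_nonneg[OF less_imp_le[OF d(1)] ln0] by linarith
    qed simp
    also have "\<dots> = 72 * (d * ln (1 / d))" by simp
    finally have "sqrt (24 * real n / 2 ^ n) \<le> sqrt (72 * (d * ln (1 / d)))" by simp
    also have "\<dots> = sqrt 72 * sqrt (d * ln (1 / d))" by (rule real_sqrt_mult)
    also have "\<dots> \<le> (150 / 17) * sqrt (d * ln (1 / d))"
      using ln0 d by (intro mult_right_mono real_le_lsqrt) (auto simp: power2_eq_square)
    finally have "17 * sqrt (24 * real n / 2 ^ n) \<le> 150 * sqrt (d * ln (1 / d))" by simp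
    hence "real CARD('d) * (17 * sqrt (24 * real n / 2 ^ n)) \<le> real CARD('d) * (150 * sqrt (d * ln (1 / d)))"
      by (rule mult_left_mono) simp
    thus ?thesis by (simp add: l_def mult_ac)
  qed
  finally show ?thesis .
qed

text \<open>The increment has variance \<open>2\<^sup>-\<^sup>n\<close>, so the tail exponent is \<open>24 n / 4 = 6 n\<close>, and \<open>e \<ge> 2\<close>.\<close>

lemma bm_dyadic_increment_tail:
  assumes "prob_space P" and bm: "std_brownian_motion_1d P B" and k: "k < 2 ^ n"
  shows "measure P {\<omega> \<in> space P. sqrt (24 * real n / 2 ^ n) <
           \<bar>B (real (Suc k) / 2 ^ n) \<omega> - B (real k / 2 ^ n) \<omega>\<bar>} \<le> 2 / 64 ^ n"
proof -
  have "real (Suc k) \<le> 2 ^ n" using k by (metis Suc_leI of_nat_le_iff of_nat_numeral of_nat_power)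
  hence le1: "real (Suc k) / 2 ^ n \<le> 1" by (simp add: divide_le_eq)
  have step: "real (Suc k) / 2 ^ n - real k / 2 ^ n = 1 / 2 ^ n" by (simp flip: diff_divide_distrib)
  have D: "distributed P lborel (\<lambda>\<omega>. B (real (Suc k) / 2 ^ n) \<omega> - B (real k / 2 ^ n) \<omega>)
      (normal_density 0 (sqrt (1 / 2 ^ n)))"
    using bm le1 unfolding std_brownian_motion_1d_def step[symmetric]
    by (auto simp: divide_strict_right_mono)
  have "measure P {\<omega> \<in> space P. sqrt (24 * real n / 2 ^ n) <
      \<bar>B (real (Suc k) / 2 ^ n) \<omega> - B (real k / 2 ^ n) \<omega>\<bar>}
    \<le> sqrt 2 * exp (- (sqrt (24 * real n / 2 ^ n))\<^sup>2 / (4 * (sqrt (1 / 2 ^ n))\<^sup>2))"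
    by (rule normal_tail_bound[OF \<open>prob_space P\<close> D]) auto
  also have "- (sqrt (24 * real n / 2 ^ n))\<^sup>2 / (4 * (sqrt (1 / 2 ^ n))\<^sup>2) = - (6 * real n)"
    by simp
  also have "sqrt 2 * exp (- (6 * real n)) \<le> 2 * (1 / 64 ^ n)"
  proof (rule mult_mono)
    show "sqrt 2 \<le> (2::real)" by (rule real_le_lsqrt) auto
    have "(2::real) ^ (6 * n) \<le> exp 1 ^ (6 * n)" using exp_ge_add_one_self[of 1] by (intro power_mono) auto
    also have "exp (1::real) ^ (6 * n) = exp (6 * real n)" by (simp flip: exp_of_nat_mult)
    finally have "64 ^ n \<le> exp (6 * real n)" by (simp add: power_mult)
    thus "exp (- (6 * real n)) \<le> 1 / 64 ^ n" by (simp add: exp_minus inverse_eq_divide frac_le)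
  qed auto
  finally show ?thesis by simp
qed

text \<open>A union bound over coordinates, over the \<open>2\<^sup>n\<close> increments of level \<open>n\<close>, and over all levels \<open>n \<ge> m\<close>; the
  level sums form a geometric series of ratio \<open>1/32\<close>.\<close>

lemma bm_dyadic_good_prob:
  fixes W :: "real \<Rightarrow> 'w \<Rightarrow> real ^ 'd::finite"
  assumes "prob_space P" and bm: "std_brownian_motion P W"
  shows "{\<omega> \<in> space P. \<not> dyadic_good m (\<lambda>s. W s \<omega>)} \<in> sets P"
    and "measure P {\<omega> \<in> space P. \<not> dyadic_good m (\<lambda>s. W s \<omega>)} \<le> 4 * real CARD('d) / 32 ^ m"
proof -
  interpret prob_space P by fact
  have bm1: "std_brownian_motion_1d P (\<lambda>s \<omega>. W s \<omega> $ i)" for i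
    using bm by (simp add: std_brownian_motion_def)
  have W_meas: "(\<lambda>\<omega>. W s \<omega> $ i) \<in> borel_measurable P" if "s \<in> {0..1}" for s i
    using bm1 that by (simp add: std_brownian_motion_1d_def)
  define E where "E n k i = {\<omega> \<in> space P. sqrt (24 * real n / 2 ^ n) <
      \<bar>W (real (Suc k) / 2 ^ n) \<omega> $ i - W (real k / 2 ^ n) \<omega> $ i\<bar>}" for n k i
  have E_sets: "E n k i \<in> sets P" if "k < 2 ^ n" for n k i
  proof -
    have "real (Suc k) \<le> 2 ^ n" using that by (metis Suc_leI of_nat_le_iff of_nat_numeral of_nat_power)
    hence [measurable]: "(\<lambda>\<omega>. W (real (Suc k) / 2 ^ n) \<omega> $ i) \<in> borel_measurable P"
      "(\<lambda>\<omega>. W (real k / 2 ^ n) \<omega> $ i) \<in> borel_measurable P"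
      using less_imp_le[OF that] by (auto intro!: W_meas simp: divide_le_eq)
    show ?thesis unfolding E_def by measurable
  qed
  define F where "F n = (\<Union>(k, i)\<in>{..<2 ^ n} \<times> UNIV. E n k i)" for n
  have F_sets: "F n \<in> sets P" for n
    unfolding F_def using E_sets by (intro sets.finite_UN) auto
  have F_prob: "measure P (F n) \<le> 2 * real CARD('d) / 32 ^ n" for n
  proof -
    have "measure P (F n) \<le> (\<Sum>(k, i)\<in>{..<2 ^ n} \<times> UNIV. measure P (E n k i))"
      unfolding F_def using E_sets
      by (intro order_trans[OF measure_subadditive_finite]) (auto simp: split_beta intro: sum_mono)
    also have "\<dots> \<le> (\<Sum>(k, i)\<in>{..<2 ^ n :: nat} \<times> (UNIV :: 'd set). 2 / 64 ^ n)"
      using bm_dyadic_increment_tail[OF \<open>prob_space P\<close> bm1]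
      by (intro sum_mono) (auto simp: E_def)
    also have "\<dots> = 2 * real CARD('d) * (2 ^ n / 64 ^ n)" by simp
    also have "(2 ^ n / 64 ^ n :: real) = 1 / 32 ^ n" by (simp flip: power_divide add: power_one_over)
    finally show ?thesis by simp
  qed
  have eq: "{\<omega> \<in> space P. \<not> dyadic_good m (\<lambda>s. W s \<omega>)} = (\<Union>j. F (m + j))"
  proof (intro set_eqI iffI)
    fix \<omega> assume "\<omega> \<in> {\<omega> \<in> space P. \<not> dyadic_good m (\<lambda>s. W s \<omega>)}"
    then obtain n k i where "\<omega> \<in> space P" "m \<le> n" "k < 2 ^ n" "\<omega> \<in> E n k i"
      by (auto simp: dyadic_good_def E_def not_le)
    hence "\<omega> \<in> F (m + (n - m))" by (auto simp: F_def)
    thus "\<omega> \<in> (\<Union>j. F (m + j))" by blast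
  next
    fix \<omega> assume "\<omega> \<in> (\<Union>j. F (m + j))"
    then obtain j k i where "k < 2 ^ (m + j)" "\<omega> \<in> E (m + j) k i" by (auto simp: F_def)
    moreover have "\<omega> \<notin> E (m + j) k i" if "dyadic_good m (\<lambda>s. W s \<omega>)"
      using that \<open>k < 2 ^ (m + j)\<close> unfolding dyadic_good_def E_def mem_Collect_eq by (meson le_add1 not_le)
    ultimately show "\<omega> \<in> {\<omega> \<in> space P. \<not> dyadic_good m (\<lambda>s. W s \<omega>)}"
      unfolding E_def by blast
  qed
  show "{\<omega> \<in> space P. \<not> dyadic_good m (\<lambda>s. W s \<omega>)} \<in> sets P"
    unfolding eq using F_sets by blast
  let ?g = "\<lambda>j. 2 * real CARD('d) / 32 ^ m * (1 / 32) ^ j"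
  have geo: "?g sums (2 * real CARD('d) / 32 ^ m * (1 / (1 - 1 / 32)))"
    by (intro sums_mult geometric_sums) simp
  have bound: "measure P (F (m + j)) \<le> ?g j" for j
    using F_prob[of "m + j"] by (simp add: power_add power_one_over)
  have summ: "summable (\<lambda>j. measure P (F (m + j)))"
    by (rule summable_comparison_test'[OF sums_summable[OF geo], of 0]) (use bound in auto)
  have "measure P (\<Union>j. F (m + j)) \<le> (\<Sum>j. measure P (F (m + j)))"
    using F_sets summ by (intro finite_measure_subadditive_countably) auto
  also have "\<dots> \<le> (\<Sum>j. ?g j)" using bound summ sums_summable[OF geo] by (rule suminf_le)
  also have "\<dots> = 2 * real CARD('d) / 32 ^ m * (1 / (1 - 1 / 32))" using geo by (rule sums_unique[symmetric])
  also have "\<dots> \<le> 4 * real CARD('d) / 32 ^ m" by (simp add: field_simps)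
  finally show "measure P {\<omega> \<in> space P. \<not> dyadic_good m (\<lambda>s. W s \<omega>)} \<le> 4 * real CARD('d) / 32 ^ m"
    unfolding eq .
qed

text \<open>The failure events decrease in \<open>m\<close> and their probabilities tend to zero. Levels from 2 on are asked for
  because chaining starts there.\<close>

lemma bm_eventually_dyadic_good:
  fixes W :: "real \<Rightarrow> 'w \<Rightarrow> real ^ 'd::finite"
  assumes "prob_space P" and "std_brownian_motion P W"
  shows "AE \<omega> in P. \<exists>m\<ge>2. dyadic_good m (\<lambda>s. W s \<omega>)"
proof -
  interpret prob_space P by fact
  let ?B = "\<lambda>m. {\<omega> \<in> space P. \<not> dyadic_good m (\<lambda>s. W s \<omega>)}"
  note bad = bm_dyadic_good_prob[OF assms]
  have sets: "(\<Inter>m\<in>{2..}. ?B m) \<in> sets P" using bad(1) by (intro sets.countable_INT') auto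
  have "(\<lambda>m. 4 * real CARD('d) * (1 / 32) ^ m) \<longlonglongrightarrow> 4 * real CARD('d) * 0"
    by (intro tendsto_intros LIMSEQ_power_zero) simp
  hence lim: "(\<lambda>m. 4 * real CARD('d) / 32 ^ m) \<longlonglongrightarrow> 0" by (simp add: power_one_over)
  have "measure P (\<Inter>m\<in>{2..}. ?B m) \<le> 4 * real CARD('d) / 32 ^ m" if "2 \<le> m" for m
    using finite_measure_mono[of "\<Inter>m\<in>{2..}. ?B m" "?B m"] bad[of m] that by fastforce
  hence "measure P (\<Inter>m\<in>{2..}. ?B m) \<le> 0"
    by (intro LIMSEQ_le_const[OF lim]) blast
  hence "measure P (\<Inter>m\<in>{2..}. ?B m) = 0" by (simp add: measure_le_0_iff)
  hence "(\<Inter>m\<in>{2..}. ?B m) \<in> null_sets P" using sets by (simp add: null_sets_def emeasure_eq_measure)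
  thus ?thesis by (rule AE_I') auto
qed

section \<open>The Gaussian form of the kernel\<close>

definition conga_kernel :: "real \<Rightarrow> real \<Rightarrow> real \<Rightarrow> real \<Rightarrow> real" where
  "conga_kernel \<alpha> t x z =
     1 / sqrt (2 * pi) * ((x + \<alpha> * z) / (2 * conga_sigma \<alpha> t * z powr (3/2)))
       * exp (- ((x - \<alpha> * z)\<^sup>2 / (2 * (conga_sigma \<alpha> t)\<^sup>2 * z)))"

text \<open>The standardised variable \<open>y(z)\<close>: the kernel is the standard normal density at \<open>y(z)\<close> times \<open>y'(z)\<close>.\<close>

definition conga_score :: "real \<Rightarrow> real \<Rightarrow> real \<Rightarrow> real \<Rightarrow> real" where
  "conga_score \<alpha> t x z = (\<alpha> * z - x) / (conga_sigma \<alpha> t * sqrt z)"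

lemma conga_line_eq:
  "conga_line \<alpha> w t x = (LBINT z:{0..1}. conga_kernel \<alpha> t x z *\<^sub>R w (1 - z))"
  unfolding conga_line_def conga_kernel_def ..

lemma conga_sigma_pos: "0 < \<alpha> \<Longrightarrow> \<alpha> < 1 \<Longrightarrow> 0 < t \<Longrightarrow> 0 < conga_sigma \<alpha> t"
  by (simp add: conga_sigma_def)

lemma conga_sigma_sq: "0 < \<alpha> \<Longrightarrow> \<alpha> < 1 \<Longrightarrow> 0 < t \<Longrightarrow> (conga_sigma \<alpha> t)\<^sup>2 = \<alpha> * (1 - \<alpha>) / t"
  by (simp add: conga_sigma_def power_divide)

lemma powr_three_halves: "0 \<le> z \<Longrightarrow> z powr (3/2) = z * sqrt z" for z :: real
  using powr_add[of z 1 "1/2"] by (simp add: powr_half_sqrt powr_one)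

lemma conga_kernel_borel [measurable]: "conga_kernel \<alpha> t x \<in> borel_measurable borel"
  unfolding conga_kernel_def by measurable

lemma conga_kernel_nonneg:
  "0 < \<alpha> \<Longrightarrow> \<alpha> < 1 \<Longrightarrow> 0 < t \<Longrightarrow> 0 \<le> x \<Longrightarrow> 0 \<le> z \<Longrightarrow> 0 \<le> conga_kernel \<alpha> t x z"
  using conga_sigma_pos[of \<alpha> t] by (simp add: conga_kernel_def)

lemma conga_kernel_eq_density:
  assumes "0 < \<alpha>" "\<alpha> < 1" "0 < t" "0 < z"
  shows "conga_kernel \<alpha> t x z = (x + \<alpha> * z) / (2 * conga_sigma \<alpha> t * z powr (3/2))
           * std_normal_density (conga_score \<alpha> t x z)"
proof -
  have "(conga_score \<alpha> t x z)\<^sup>2 = (x - \<alpha> * z)\<^sup>2 / ((conga_sigma \<alpha> t)\<^sup>2 * z)"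
    using \<open>0 < z\<close> by (simp add: conga_score_def power_divide power_mult_distrib power2_commute)
  thus ?thesis by (simp add: conga_kernel_def normal_density_def mult_ac)
qed

lemma conga_score_deriv:
  assumes "0 < \<alpha>" "\<alpha> < 1" "0 < t" "0 < z"
  shows "(conga_score \<alpha> t x has_field_derivative
           (x + \<alpha> * z) / (2 * conga_sigma \<alpha> t * z powr (3/2))) (at z within S)"
proof -
  let ?s = "conga_sigma \<alpha> t"
  have s: "0 < ?s" using conga_sigma_pos assms by blast
  have r: "sqrt z * sqrt z = z" "0 < sqrt z" using \<open>0 < z\<close> by auto
  have "((\<lambda>z. (\<alpha> * z - x) / (?s * sqrt z)) has_field_derivative
      (\<alpha> * (?s * sqrt z) - (\<alpha> * z - x) * (?s * (inverse (sqrt z) / 2))) / ((?s * sqrt z) * (?s * sqrt z)))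
      (at z within S)"
    using s \<open>0 < z\<close> by (auto intro!: derivative_eq_intros)
  also have "(\<alpha> * (?s * sqrt z) - (\<alpha> * z - x) * (?s * (inverse (sqrt z) / 2))) / ((?s * sqrt z) * (?s * sqrt z))
      = (x + \<alpha> * z) / (2 * ?s * z powr (3/2))"
  proof -
    define q where "q = sqrt z"
    have q: "0 < q" "z = q * q" using r by (simp_all add: q_def)
    have "z powr (3/2) = q * q * q" using powr_three_halves[of z] \<open>0 < z\<close> by (simp add: q_def)
    thus ?thesis using s q unfolding q_def[symmetric]
      by (simp add: field_simps)
  qed
  finally show ?thesis unfolding conga_score_def .
qed

text \<open>Writing \<open>\<sigma>\<^sub>t y(z) = \<alpha> sqrt z - x / sqrt z\<close> shows that the score increases strictly from
  \<open>-\<infinity>\<close> to \<open>\<infinity>\<close>.\<close>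

lemma conga_score_bij:
  assumes "0 < \<alpha>" "\<alpha> < 1" "0 < t" "0 < x"
  shows "bij_betw (conga_score \<alpha> t x) {0<..} UNIV"
proof -
  let ?s = "conga_sigma \<alpha> t"
  have s: "0 < ?s" using conga_sigma_pos assms by blast
  have mono: "conga_score \<alpha> t x a < conga_score \<alpha> t x b" if "0 < a" "a < b" for a b
  proof -
    have *: "conga_score \<alpha> t x c = (\<alpha> * sqrt c - x / sqrt c) / ?s" if "0 < c" for c
    proof -
      have "\<alpha> * sqrt c - x / sqrt c = (\<alpha> * c - x) / sqrt c"
        using \<open>0 < c\<close> real_sqrt_mult_self[of c] by (simp add: field_simps)
      thus ?thesis by (simp add: conga_score_def mult.commute)
    qed
    have "\<alpha> * sqrt a < \<alpha> * sqrt b" using that assms by simp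
    moreover have "x / sqrt b < x / sqrt a" using that assms by (simp add: divide_strict_left_mono)
    ultimately show ?thesis using that s *[of a] *[of b] by (simp add: divide_strict_right_mono)
  qed
  have inj: "inj_on (conga_score \<alpha> t x) {0<..}"
    by (rule inj_onI) (metis mono greaterThan_iff less_irrefl linorder_neqE_linordered_idom)
  have "\<exists>z>0. conga_score \<alpha> t x z = v" for v
  proof -
    \<comment> \<open>In terms of \<open>r = sqrt z\<close> the equation is the quadratic \<open>\<alpha> r\<^sup>2 = x + \<sigma> v r\<close>, of which \<open>r\<close> is the positive root.\<close>
    define D where "D = (?s * v)\<^sup>2 + 4 * \<alpha> * x"
    define r where "r = (?s * v + sqrt D) / (2 * \<alpha>)"
    have "\<bar>?s * v\<bar> < sqrt D"
      by (rule real_less_rsqrt) (use assms in \<open>simp add: D_def\<close>)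
    hence "0 < r" using assms by (simp add: r_def)
    have "(2 * \<alpha> * r - ?s * v)\<^sup>2 = D"
      using assms by (simp add: r_def D_def)
    hence "\<alpha> * (\<alpha> * (r * r)) = \<alpha> * (x + ?s * v * r)"
      unfolding D_def by (simp add: power2_eq_square algebra_simps)
    hence "\<alpha> * (r * r) - x = v * (?s * r)" using assms by simp
    hence "conga_score \<alpha> t x (r * r) = v"
      using \<open>0 < r\<close> s by (simp add: conga_score_def)
    thus ?thesis using \<open>0 < r\<close> by (intro exI[of _ "r * r"]) simp
  qed
  hence "conga_score \<alpha> t x ` {0<..} = UNIV" by (metis (mono_tags) UNIV_eq_I greaterThan_iff image_eqI)
  thus ?thesis using inj by (simp add: bij_betw_def)
qed

text \<open>Integration against the kernel over the whole half line is integration against a standard normal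
  variable; in particular the kernel has mass one there.\<close>

lemma conga_kernel_change_of_variables:
  fixes f :: "real \<Rightarrow> real"
  assumes "0 < \<alpha>" "\<alpha> < 1" "0 < t" "0 < x"
    and [measurable]: "f \<in> borel_measurable borel"
    and int: "integrable lborel (\<lambda>v. std_normal_density v * f v)"
  shows "set_integrable lborel {0<..} (\<lambda>z. conga_kernel \<alpha> t x z * f (conga_score \<alpha> t x z))"
    and "(LBINT z:{0<..}. conga_kernel \<alpha> t x z * f (conga_score \<alpha> t x z))
          = integral\<^sup>L lborel (\<lambda>v. std_normal_density v * f v)"
proof -
  let ?g = "conga_score \<alpha> t x" and ?F = "\<lambda>v. std_normal_density v * f v"
  define g' where "g' z = (x + \<alpha> * z) / (2 * conga_sigma \<alpha> t * z powr (3/2))" for z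
  let ?K = "\<lambda>z. conga_kernel \<alpha> t x z * f (?g z)"
  have g'_pos: "0 \<le> g' z" if "0 < z" for z
    using that assms conga_sigma_pos[of \<alpha> t] by (simp add: g'_def)
  have [measurable]: "?g \<in> borel_measurable borel" unfolding conga_score_def by measurable
  have img: "?g ` {0<..} = UNIV" and inj: "inj_on ?g {0<..}"
    using conga_score_bij[of \<alpha> t x] assms by (auto simp: bij_betw_def)
  have K: "\<bar>g' z\<bar> * ?F (?g z) = ?K z" if "z \<in> {0<..}" for z
    using that g'_pos[of z] conga_kernel_eq_density[of \<alpha> t z x] assms(1-3)
    unfolding g'_def[symmetric] by (simp add: mult.assoc)
  have intU: "set_integrable lborel UNIV ?F" using int by (simp add: set_integrable_def)
  hence "?F absolutely_integrable_on ?g ` {0<..}"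
    unfolding img set_integrable_def by (subst integrable_completion) auto
  moreover have "integral (?g ` {0<..}) ?F = integral\<^sup>L lborel ?F"
    unfolding img using set_borel_integral_eq_integral(2)[OF intU] by (simp add: set_lebesgue_integral_def)
  ultimately have "(\<lambda>z. \<bar>g' z\<bar> * ?F (?g z)) absolutely_integrable_on {0<..}
      \<and> integral {0<..} (\<lambda>z. \<bar>g' z\<bar> * ?F (?g z)) = integral\<^sup>L lborel ?F"
  proof (intro iffD2[OF has_absolute_integral_change_of_variables_1'[of "{0<..}" ?g g' ?F]] conjI)
    show "(?g has_field_derivative g' z) (at z within {0<..})" if "z \<in> {0<..}" for z
      unfolding g'_def using conga_score_deriv assms that by simp
  qed (use inj in auto)
  hence 0: "(\<lambda>z. \<bar>g' z\<bar> * ?F (?g z)) absolutely_integrable_on {0<..}"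
    and "integral {0<..} (\<lambda>z. \<bar>g' z\<bar> * ?F (?g z)) = integral\<^sup>L lborel ?F" by blast+
  moreover have "integral {0<..} (\<lambda>z. \<bar>g' z\<bar> * ?F (?g z)) = integral {0<..} ?K"
    by (rule integral_cong) (rule K)
  ultimately have 2: "integral {0<..} ?K = integral\<^sup>L lborel ?F" by simp
  have 1: "?K absolutely_integrable_on {0<..}"
    by (rule iffD1[OF set_integrable_cong[OF refl refl K] 0])
  show S: "set_integrable lborel {0<..} ?K"
    using 1 unfolding set_integrable_def by (subst (asm) integrable_completion) auto
  show "(LBINT z:{0<..}. ?K z) = integral\<^sup>L lborel ?F"
    by (rule trans[OF set_borel_integral_eq_integral(2)[OF S] 2])
qed

text \<open>Since \<open>\<bar>\<alpha> z - x\<bar> = b sqrt z\<close>, only an upper bound for \<open>sqrt z\<close> is wanted, and \<open>\<alpha> sqrt z \<le> b + sqrt(\<alpha> x)\<close>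
  follows from the quadratic equation for \<open>sqrt z\<close>.\<close>

lemma dist_le_conga_score:
  assumes "0 < \<alpha>" "\<alpha> < 1" "0 < t" "0 < x" "0 < z"
  defines "b \<equiv> \<bar>conga_score \<alpha> t x z\<bar> * conga_sigma \<alpha> t"
  shows "\<bar>z - x / \<alpha>\<bar> \<le> b * (b + sqrt (\<alpha> * x)) / \<alpha>\<^sup>2"
proof -
  let ?s = "conga_sigma \<alpha> t"
  define r where "r = sqrt z"
  have s: "0 < ?s" using conga_sigma_pos assms by blast
  have r: "0 < r" "z = r * r" using \<open>0 < z\<close> by (simp_all add: r_def)
  have b0: "0 \<le> b" using s by (simp add: b_def)
  have "\<alpha> * z - x = conga_score \<alpha> t x z * ?s * r"
    using s \<open>0 < z\<close> by (simp add: conga_score_def r_def)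
  hence eq: "\<bar>\<alpha> * z - x\<bar> = b * r" using s r(1) by (simp add: b_def abs_mult)
  \<comment> \<open>A larger \<open>r\<close> would make both factors of \<open>(\<alpha> r - b) (\<alpha> r)\<close> exceed \<open>sqrt(\<alpha> x)\<close>.\<close>
  have "\<alpha> * r \<le> b + sqrt (\<alpha> * x)"
  proof (rule ccontr)
    assume "\<not> ?thesis"
    hence lt: "b + sqrt (\<alpha> * x) < \<alpha> * r" by simp
    have "sqrt (\<alpha> * x) * sqrt (\<alpha> * x) < (\<alpha> * r - b) * (\<alpha> * r)"
    proof (rule mult_strict_mono)
      show "sqrt (\<alpha> * x) < \<alpha> * r" using lt b0 by linarith
      show "sqrt (\<alpha> * x) < \<alpha> * r - b" using lt by linarith
      have "0 < sqrt (\<alpha> * x)" using assms(1,4) by simp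
      thus "0 < \<alpha> * r - b" using lt by linarith
      show "0 \<le> sqrt (\<alpha> * x)" using assms(1,4) by simp
    qed
    hence "\<alpha> * x < \<alpha> * (\<alpha> * z - b * r)" using assms(1,4) r(2) by (simp add: algebra_simps)
    hence "x < \<alpha> * z - b * r" using assms(1) by simp
    thus False using eq by linarith
  qed
  hence "b * (\<alpha> * r) \<le> b * (b + sqrt (\<alpha> * x))" using b0 by (rule mult_left_mono)
  moreover have "\<bar>z - x / \<alpha>\<bar> = b * (\<alpha> * r) / \<alpha>\<^sup>2"
  proof -
    have "z - x / \<alpha> = (\<alpha> * z - x) / \<alpha>" using assms(1) by (simp add: field_simps)
    hence "\<bar>z - x / \<alpha>\<bar> = b * r / \<alpha>" using eq assms(1) by (simp add: abs_divide)
    thus ?thesis using assms(1) by (simp add: power2_eq_square)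
  qed
  ultimately show ?thesis by (simp add: divide_right_mono)
qed

section \<open>Approximation along a single path\<close>

text \<open>Measured in units of \<open>sqrt(x/t)\<close>, the distance of \<open>z\<close> from \<open>x/\<alpha>\<close> has a part linear in the score and a
  quadratic part with coefficient of order \<open>1 / sqrt(x t)\<close>; the lower bound \<open>c\<close> for \<open>x t\<close> keeps the latter
  bounded.\<close>

lemma conga_score_increment:
  assumes "0 < \<alpha>" "\<alpha> < 1" "0 < t" "0 < x" "0 < z" "0 < c" "c \<le> x * t"
  shows "\<bar>z - x / \<alpha>\<bar> / sqrt (x / t) + 1
           \<le> (1 + (1 + 1 / sqrt c) / \<alpha>\<^sup>2) * (1 + (conga_score \<alpha> t x z)\<^sup>2)"
proof -
  define y where "y = \<bar>conga_score \<alpha> t x z\<bar>"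
  define s where "s = conga_sigma \<alpha> t"
  define d where "d = sqrt (x / t)"
  have d: "0 < d" using assms by (simp add: d_def)
  have y: "0 \<le> y" "y \<le> 1 + y\<^sup>2"
    using zero_le_power2[of "y - 1/2"] by (auto simp: y_def power2_eq_square algebra_simps)
  have "\<alpha> * (1 - \<alpha>) \<le> 1 * 1" using assms by (intro mult_mono) auto
  hence s2: "s\<^sup>2 \<le> 1 / t" using assms conga_sigma_sq[of \<alpha> t] by (simp add: s_def divide_right_mono)
  have s: "0 \<le> s" "s \<le> 1 / sqrt t"
    using conga_sigma_pos[of \<alpha> t] assms real_le_rsqrt[OF s2] by (auto simp: s_def real_sqrt_divide)
  have "s * sqrt (\<alpha> * x) \<le> (1 / sqrt t) * sqrt x"
    using s assms by (intro mult_mono) auto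
  hence linear: "s * sqrt (\<alpha> * x) \<le> d" by (simp add: d_def real_sqrt_divide)
  have "sqrt c \<le> sqrt (x * t)" using assms by simp
  also have "\<dots> = t * d" using assms real_sqrt_mult_self[of t]
    by (simp add: d_def real_sqrt_divide real_sqrt_mult field_simps del: real_sqrt_mult_self)
  finally have "1 / t \<le> d / sqrt c" using assms by (simp add: field_simps)
  hence quadratic: "s\<^sup>2 \<le> d / sqrt c" using s2 by linarith
  have "\<bar>z - x / \<alpha>\<bar> \<le> (y * s) * (y * s + sqrt (\<alpha> * x)) / \<alpha>\<^sup>2"
    using dist_le_conga_score[of \<alpha> t x z] assms by (simp add: y_def s_def)
  also have "(y * s) * (y * s + sqrt (\<alpha> * x)) = y\<^sup>2 * s\<^sup>2 + y * (s * sqrt (\<alpha> * x))"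
    by (simp add: algebra_simps power2_eq_square)
  also have "\<dots> / \<alpha>\<^sup>2 \<le> (y\<^sup>2 * (d / sqrt c) + y * d) / \<alpha>\<^sup>2"
    using quadratic linear y by (intro divide_right_mono add_mono mult_left_mono) auto
  also have "\<dots> = d * ((y\<^sup>2 * (1 / sqrt c) + y) / \<alpha>\<^sup>2)" by (simp add: field_simps)
  finally have "\<bar>z - x / \<alpha>\<bar> / d \<le> (y\<^sup>2 * (1 / sqrt c) + y) / \<alpha>\<^sup>2"
    using d by (simp add: divide_le_eq mult.commute)
  also have "\<dots> \<le> ((1 + y\<^sup>2) * (1 / sqrt c) + (1 + y\<^sup>2)) / \<alpha>\<^sup>2"
    using y assms by (intro divide_right_mono add_mono mult_right_mono) auto
  also have "\<dots> = ((1 + 1 / sqrt c) / \<alpha>\<^sup>2) * (1 + y\<^sup>2)"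
    by (simp add: add_divide_distrib distrib_right distrib_left mult.commute)
  also have "\<dots> \<le> (1 + (1 + 1 / sqrt c) / \<alpha>\<^sup>2) * (1 + y\<^sup>2) - 1"
    unfolding distrib_right[of 1 "(1 + 1 / sqrt c) / \<alpha>\<^sup>2"] by simp
  finally show ?thesis by (simp add: y_def d_def)
qed

text \<open>The Gaussian average of the increment bound of the path. The constant is twice that of
  \<open>conga_score_increment\<close> because \<open>1 + y\<^sup>2\<close> has mean 2.\<close>

lemma conga_line_approximation:
  fixes w :: "real \<Rightarrow> real ^ 'd::finite"
  assumes \<alpha>: "0 < \<alpha>" "\<alpha> < 1" and t: "0 < t" and x: "0 < x" "x \<le> \<alpha>"
    and c: "0 < c" "c \<le> x * t"
    and cont: "continuous_on {0..1} w" and w0: "w 0 = 0"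
    and mod: "\<And>a b. a \<in> {0..1} \<Longrightarrow> b \<in> {0..1} \<Longrightarrow> \<bar>a - b\<bar> \<le> sqrt (x / t) \<Longrightarrow> norm (w a - w b) \<le> A"
  shows "norm (conga_line \<alpha> w t x - w (1 - x / \<alpha>)) \<le> 2 * (1 + (1 + 1 / sqrt c) / \<alpha>\<^sup>2) * A"
proof -
  define C where "C = 1 + (1 + 1 / sqrt c) / \<alpha>\<^sup>2"
  define p where "p = w (1 - x / \<alpha>)"
  \<comment> \<open>The reversed path, frozen at \<open>w 0 = 0\<close> for \<open>z > 1\<close>.\<close>
  define e where "e z = w (max 0 (min 1 (1 - z)))" for z
  let ?k = "conga_kernel \<alpha> t x" and ?y = "conga_score \<alpha> t x"
  have "0 \<le> A" using mod[of 0 0] x t by simp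
  have cont_e: "continuous_on UNIV e"
    unfolding e_def by (intro continuous_on_compose2[OF cont] continuous_intros) auto
  have [measurable]: "e \<in> borel_measurable borel"
    using cont_e by (rule borel_measurable_continuous_onI)
  have k0: "0 \<le> ?k z" if "0 < z" for z
    using conga_kernel_nonneg \<alpha> t x that by simp
  have incr: "norm (e z - p) \<le> A * C * (1 + (?y z)\<^sup>2)" if z: "0 < z" for z
  proof -
    have in01: "1 - x / \<alpha> \<in> {0..1}" using x \<alpha> by (simp add: divide_le_eq)
    have "\<bar>max 0 (min 1 (1 - z)) - (1 - x / \<alpha>)\<bar> \<le> \<bar>z - x / \<alpha>\<bar>"
      using in01 z unfolding atLeastAtMost_iff by linarith
    hence clamp: "\<bar>max 0 (min 1 (1 - z)) - (1 - x / \<alpha>)\<bar> / sqrt (x / t) \<le> \<bar>z - x / \<alpha>\<bar> / sqrt (x / t)"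
      using x t by (intro divide_right_mono) auto
    have "norm (e z - p) \<le> A * (\<bar>max 0 (min 1 (1 - z)) - (1 - x / \<alpha>)\<bar> / sqrt (x / t) + 1)"
      unfolding e_def p_def by (rule norm_diff_le_steps[OF mod]) (use in01 x t in auto)
    also have "\<dots> \<le> A * (\<bar>z - x / \<alpha>\<bar> / sqrt (x / t) + 1)"
      using clamp \<open>0 \<le> A\<close> by (intro mult_left_mono add_right_mono)
    also have "\<dots> \<le> A * (C * (1 + (?y z)\<^sup>2))"
      unfolding C_def using conga_score_increment \<alpha> t x z c \<open>0 \<le> A\<close> by (intro mult_left_mono) auto
    finally show ?thesis by (simp add: mult.assoc)
  qed
  have int1: "integrable lborel (\<lambda>v. std_normal_density v * 1)"
    and val1: "integral\<^sup>L lborel (\<lambda>v. std_normal_density v * 1) = 1"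
    using integrable_std_normal_moment[of 0] integral_std_normal_moment_even[of 0] by simp_all
  have int2: "integrable lborel (\<lambda>v. std_normal_density v * v\<^sup>2)"
    and val2: "integral\<^sup>L lborel (\<lambda>v. std_normal_density v * v\<^sup>2) = 1"
    using integrable_std_normal_moment[of 2] integral_std_normal_moment_even[of 1] by simp_all
  have split: "std_normal_density v * (A * C * (1 + v\<^sup>2))
      = (A * C) * (std_normal_density v * 1 + std_normal_density v * v\<^sup>2)" for v
    by (simp add: algebra_simps)
  have int3: "integrable lborel (\<lambda>v. std_normal_density v * (A * C * (1 + v\<^sup>2)))"
    unfolding split by (intro integrable_mult_right Bochner_Integration.integrable_add int1 int2)
  have val3: "integral\<^sup>L lborel (\<lambda>v. std_normal_density v * (A * C * (1 + v\<^sup>2))) = 2 * C * A"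
    unfolding split using val1 val2 int1 int2 by simp
  have K: "set_integrable lborel {0<..} ?k" "(LBINT z:{0<..}. ?k z) = 1"
    using conga_kernel_change_of_variables[OF \<alpha> t x(1) _ int1] val1 by simp_all
  have H: "set_integrable lborel {0<..} (\<lambda>z. ?k z * (A * C * (1 + (?y z)\<^sup>2)))"
    "(LBINT z:{0<..}. ?k z * (A * C * (1 + (?y z)\<^sup>2))) = 2 * C * A"
    using conga_kernel_change_of_variables[OF \<alpha> t x(1) _ int3] val3 by simp_all
  have D: "set_integrable lborel {0<..} (\<lambda>z. ?k z *\<^sub>R (e z - p))"
  proof (rule set_integrable_bound[OF H(1)])
    show "set_borel_measurable lborel {0<..} (\<lambda>z. ?k z *\<^sub>R (e z - p))"
      unfolding set_borel_measurable_def by measurable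
    show "AE z in lborel. z \<in> {0<..} \<longrightarrow>
        norm (?k z *\<^sub>R (e z - p)) \<le> norm (?k z * (A * C * (1 + (?y z)\<^sup>2)))"
    proof (intro AE_I2 impI)
      fix z :: real assume "z \<in> {0<..}"
      hence "norm (?k z *\<^sub>R (e z - p)) \<le> ?k z * (A * C * (1 + (?y z)\<^sup>2))"
        using incr[of z] k0[of z] by (auto intro!: mult_left_mono)
      thus "norm (?k z *\<^sub>R (e z - p)) \<le> norm (?k z * (A * C * (1 + (?y z)\<^sup>2)))"
        by simp
    qed
  qed
  have P: "set_integrable lborel {0<..} (\<lambda>z. ?k z *\<^sub>R p)"
    using K(1) by (rule set_integrable_scaleR_left)
  \<comment> \<open>The two integrands agree everywhere: the kernel vanishes at \<open>z = 0\<close>, where it divides by zero, and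
      \<open>e\<close> vanishes beyond \<open>z = 1\<close>.\<close>
  have "conga_line \<alpha> w t x = (LBINT z:{0<..}. ?k z *\<^sub>R e z)"
    unfolding conga_line_eq set_lebesgue_integral_def
  proof (intro Bochner_Integration.integral_cong refl)
    fix z :: real
    consider "z < 0" | "z = 0" | "0 < z" "z \<le> 1" | "1 < z" by linarith
    thus "indicator {0..1} z *\<^sub>R ?k z *\<^sub>R w (1 - z) = indicator {0<..} z *\<^sub>R ?k z *\<^sub>R e z"
    proof cases
      case 2 thus ?thesis by (simp add: conga_kernel_def)
    next
      case 4 thus ?thesis using w0 by (simp add: e_def)
    qed (auto simp: e_def)
  qed
  also have "\<dots> = (LBINT z:{0<..}. ?k z *\<^sub>R (e z - p) + ?k z *\<^sub>R p)"
    by (simp add: scaleR_diff_right)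
  also have "\<dots> = (LBINT z:{0<..}. ?k z *\<^sub>R (e z - p)) + (LBINT z:{0<..}. ?k z *\<^sub>R p)"
    by (rule set_integral_add(2)[OF D P])
  also have "(LBINT z:{0<..}. ?k z *\<^sub>R p) = p"
  proof -
    have "(LBINT z:{0<..}. ?k z *\<^sub>R p) = (\<integral>z. (indicator {0<..} z *\<^sub>R ?k z) *\<^sub>R p \<partial>lborel)"
      by (simp add: set_lebesgue_integral_def)
    also have "\<dots> = (LBINT z:{0<..}. ?k z) *\<^sub>R p"
      using K(1) unfolding set_integrable_def set_lebesgue_integral_def
      by (intro integral_scaleR_left) simp
    finally show ?thesis using K(2) by simp
  qed
  finally have "norm (conga_line \<alpha> w t x - p) = norm (LBINT z:{0<..}. ?k z *\<^sub>R (e z - p))" by simp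
  also have "\<dots> \<le> (LBINT z:{0<..}. norm (?k z *\<^sub>R (e z - p)))"
    using D by (rule set_integral_norm_bound)
  also have "\<dots> \<le> (LBINT z:{0<..}. ?k z * (A * C * (1 + (?y z)\<^sup>2)))"
    using incr k0 by (intro set_integral_mono set_integrable_norm D H(1)) (auto intro!: mult_left_mono)
  also note H(2)
  finally show ?thesis by (simp add: p_def C_def)
qed

text \<open>With \<open>\<delta> = sqrt(x/t)\<close>, Levy's modulus \<open>sqrt(\<delta> log(1/\<delta>))\<close> is the rate divided by \<open>sqrt 2\<close>.\<close>

lemma sqrt_modulus_le_conga_rate:
  assumes "0 < x" "x \<le> t"
  shows "sqrt (sqrt (x / t) * ln (1 / sqrt (x / t))) \<le> conga_rate t x"
proof -
  have pos: "0 < x / t" "x / t \<le> 1" using assms by auto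
  have "sqrt (x / t) * ln (1 / sqrt (x / t)) = (1 / 2) * - (sqrt (x / t) * ln (x / t))"
    using pos by (simp add: ln_div ln_sqrt del: real_sqrt_divide)
  also have "\<dots> \<le> 1 * - (sqrt (x / t) * ln (x / t))"
    using pos by (intro mult_right_mono) (auto simp: mult_nonneg_nonpos simp del: real_sqrt_divide)
  finally show ?thesis
    using pos by (simp add: conga_rate_def powr_half_sqrt del: real_sqrt_divide)
qed

text \<open>The deterministic core of all three assertions. The hypothesis \<open>2\<^sup>m \<le> sqrt t\<close> brings the scale
  \<open>sqrt(x/t)\<close> below \<open>2\<^sup>-\<^sup>m\<close> for all \<open>x \<le> \<alpha>\<close> at once.\<close>

lemma conga_line_bound:
  fixes w :: "real \<Rightarrow> real ^ 'd::finite"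
  assumes \<alpha>: "0 < \<alpha>" "\<alpha> < 1" and x: "0 < x" "x \<le> \<alpha>" and c: "0 < c" "c \<le> x * t"
    and t: "2 ^ m \<le> sqrt t" and m: "2 \<le> m" and good: "dyadic_good m w"
    and cont: "continuous_on {0..1} w" and w0: "w 0 = 0"
  shows "norm (conga_line \<alpha> w t x - w (1 - x / \<alpha>))
           \<le> (300 * real CARD('d) * (1 + (1 + 1 / sqrt c) / \<alpha>\<^sup>2)) * conga_rate t x"
proof -
  have "1 \<le> (2::real) ^ m" by simp
  hence t1: "1 \<le> t" using t by (metis order_trans real_sqrt_ge_1_iff)
  define d where "d = sqrt (x / t)"
  have d0: "0 < d" using x t1 by (simp add: d_def)
  have "d \<le> sqrt (1 / t)"
    unfolding d_def using x \<alpha> t1 by (intro real_sqrt_le_mono divide_right_mono) auto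
  also have "\<dots> = 1 / sqrt t" by (simp add: real_sqrt_divide)
  also have "\<dots> \<le> 1 / 2 ^ m" using t by (intro divide_left_mono) (use t1 in auto)
  finally have d1: "d \<le> 1 / 2 ^ m" .
  have "sqrt (d * ln (1 / d)) \<le> conga_rate t x"
    unfolding d_def using x \<alpha> t1 by (intro sqrt_modulus_le_conga_rate) auto
  hence "150 * real CARD('d) * sqrt (d * ln (1 / d)) \<le> 150 * real CARD('d) * conga_rate t x"
    by (intro mult_left_mono) auto
  hence mod: "norm (w a - w b) \<le> 150 * real CARD('d) * conga_rate t x"
    if "a \<in> {0..1}" "b \<in> {0..1}" "\<bar>a - b\<bar> \<le> sqrt (x / t)" for a b
    using dyadic_good_modulus[OF good m cont d0 d1 that(1,2)] that(3) unfolding d_def[symmetric] by linarith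
  have "norm (conga_line \<alpha> w t x - w (1 - x / \<alpha>))
      \<le> 2 * (1 + (1 + 1 / sqrt c) / \<alpha>\<^sup>2) * (150 * real CARD('d) * conga_rate t x)"
    by (rule conga_line_approximation[OF \<alpha> _ x c cont w0 mod]) (use t1 in auto)
  thus ?thesis by (simp add: mult_ac)
qed

text \<open>Squaring \<open>\<alpha> L < x\<close> gives \<open>x > M \<sigma>\<^sub>t\<^sup>2 log(1 / (\<sigma>\<^sub>t\<^sup>2 x))\<close>, and the logarithm is at least 1 from \<open>t = 3\<close> on.\<close>

lemma conga_L_region:
  assumes "0 < \<alpha>" "\<alpha> < 1" "1 \<le> M" "3 \<le> t" "0 < x" "x \<le> \<alpha>" and L: "\<alpha> * conga_L \<alpha> M t x < x"
  shows "\<alpha> * (1 - \<alpha>) \<le> x * t"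
proof -
  define s where "s = (conga_sigma \<alpha> t)\<^sup>2"
  have s: "s = \<alpha> * (1 - \<alpha>) / t" "0 < s" using assms by (auto simp: s_def conga_sigma_sq)
  have sx: "0 < s * x" using s(2) \<open>0 < x\<close> by simp
  have "\<alpha> * (1 - \<alpha>) \<le> 1" using assms(1,2) by (intro mult_le_one) auto
  hence "\<alpha> * (1 - \<alpha>) * x \<le> 1" using assms(1,2,5,6) by (intro mult_le_one) auto
  hence "s * x \<le> 1 / t" using \<open>3 \<le> t\<close> by (simp add: s(1) divide_right_mono)
  also have "1 / t \<le> 1 / 3" using \<open>3 \<le> t\<close> by (simp add: frac_le)
  also have "1 / 3 \<le> exp (- 1 :: real)"
    unfolding exp_minus inverse_eq_divide using exp_le by (intro divide_left_mono) auto
  finally have "ln (s * x) \<le> ln (exp (- 1))" using sx by (intro ln_mono) auto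
  hence ln: "1 \<le> - ln (s * x)" by simp
  have "s * x * 1 \<le> (M * (s * x)) * - ln (s * x)"
    using ln sx mult_right_mono[OF \<open>1 \<le> M\<close>, of "s * x"] by (intro mult_mono[of "s * x" "M * (s * x)"]) auto
  also have "\<dots> = - (M * s * x * ln (s * x))" by simp
  finally have "sqrt (s * x) \<le> sqrt (- (M * s * x * ln (s * x)))" by simp
  also have "\<dots> = \<alpha> * conga_L \<alpha> M t x" using \<open>0 < \<alpha>\<close> by (simp add: conga_L_def s_def)
  also note L
  finally have "sqrt (s * x) < sqrt (x * x)" using \<open>0 < x\<close> by simp
  hence "s * x < x * x" by (simp only: real_sqrt_less_iff)
  hence "s < x" using \<open>0 < x\<close> by simp
  thus ?thesis using \<open>3 \<le> t\<close> by (simp add: s(1) divide_less_eq)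
qed

section \<open>Measurability of the exceptional event\<close>

text \<open>A continuous process is the pointwise limit of its discretisations at times \<open>\<lfloor>n z\<rfloor> / n\<close>, hence jointly
  measurable in time and sample point; integrating out the time keeps measurability.\<close>

lemma conga_line_measurable:
  fixes X :: "real \<Rightarrow> 'w \<Rightarrow> real ^ 'd::finite"
  assumes meas: "\<And>s. s \<in> {0..1} \<Longrightarrow> X s \<in> borel_measurable P"
    and cont: "\<And>\<omega>. \<omega> \<in> space P \<Longrightarrow> continuous_on {0..1} (\<lambda>s. X s \<omega>)"
  shows "(\<lambda>\<omega>. conga_line \<alpha> (\<lambda>s. X s \<omega>) t x) \<in> borel_measurable P"
proof -
  \<comment> \<open>Clamping to \<open>[0,1]\<close> extends the process to all real times.\<close>
  define c :: "real \<Rightarrow> real" where "c s = max 0 (min 1 s)" for s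
  have c01: "c s \<in> {0..1}" for s by (auto simp: c_def)
  have approx: "(\<lambda>(\<omega>, z). X (c (real_of_int \<lfloor>real n * z\<rfloor> / real n)) \<omega>) \<in> borel_measurable (P \<Otimes>\<^sub>M borel)" for n
  proof -
    have "(\<lambda>p. (\<lambda>i p. X (c (real_of_int i / real n)) (fst p)) \<lfloor>real n * snd p\<rfloor> p)
        \<in> borel_measurable (P \<Otimes>\<^sub>M borel)"
      by (rule measurable_compose_countable)
         (use measurable_compose[OF measurable_fst meas[OF c01]] in auto)
    thus ?thesis by (simp add: case_prod_unfold)
  qed
  have "(\<lambda>(\<omega>, z). X (c z) \<omega>) \<in> borel_measurable (P \<Otimes>\<^sub>M borel)"
  proof (rule borel_measurable_LIMSEQ_metric[OF approx], clarsimp simp: space_pair_measure)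
    fix \<omega> and z :: real assume "\<omega> \<in> space P"
    have "(\<lambda>n. real_of_int \<lfloor>real n * z\<rfloor> / real n) \<longlonglongrightarrow> z"
    proof (rule tendsto_sandwich)
      show "\<forall>\<^sub>F n in sequentially. z - 1 / real n \<le> real_of_int \<lfloor>real n * z\<rfloor> / real n"
      proof (rule eventually_sequentiallyI[of 1])
        fix n :: nat assume "1 \<le> n"
        hence "z - 1 / real n = (real n * z - 1) / real n" by (simp add: field_simps)
        also have "\<dots> \<le> real_of_int \<lfloor>real n * z\<rfloor> / real n"
          by (intro divide_right_mono) linarith+
        finally show "z - 1 / real n \<le> real_of_int \<lfloor>real n * z\<rfloor> / real n" .
      qed
      show "\<forall>\<^sub>F n in sequentially. real_of_int \<lfloor>real n * z\<rfloor> / real n \<le> z"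
      proof (rule eventually_sequentiallyI[of 1])
        fix n :: nat assume "1 \<le> n"
        have "real_of_int \<lfloor>real n * z\<rfloor> / real n \<le> (real n * z) / real n"
          by (intro divide_right_mono) linarith+
        thus "real_of_int \<lfloor>real n * z\<rfloor> / real n \<le> z" using \<open>1 \<le> n\<close> by simp
      qed
      show "(\<lambda>n. z - 1 / real n) \<longlonglongrightarrow> z"
        using tendsto_diff[OF tendsto_const lim_1_over_n, of z] by simp
    qed simp
    hence "(\<lambda>n. c (real_of_int \<lfloor>real n * z\<rfloor> / real n)) \<longlonglongrightarrow> c z"
      unfolding c_def by (intro tendsto_intros)
    thus "(\<lambda>n. X (c (real_of_int \<lfloor>real n * z\<rfloor> / real n)) \<omega>) \<longlonglongrightarrow> X (c z) \<omega>"
      by (rule continuous_on_tendsto_compose[OF cont[OF \<open>\<omega> \<in> space P\<close>] _ c01]) (simp add: c01 del: atLeastAtMost_iff)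
  qed
  hence [measurable]: "(\<lambda>p. X (c (snd p)) (fst p)) \<in> borel_measurable (P \<Otimes>\<^sub>M borel)"
    by (simp add: case_prod_unfold)
  have [measurable]: "(\<lambda>p. X (c (1 - snd p)) (fst p)) \<in> borel_measurable (P \<Otimes>\<^sub>M borel)"
    using measurable_compose[of "\<lambda>p. (fst p, 1 - snd p)" "P \<Otimes>\<^sub>M borel" "P \<Otimes>\<^sub>M borel"
        "\<lambda>p. X (c (snd p)) (fst p)" borel] by simp
  have "(\<lambda>\<omega>. \<integral>z. indicator {0..1} z *\<^sub>R conga_kernel \<alpha> t x z *\<^sub>R X (c (1 - z)) \<omega> \<partial>lborel) \<in> borel_measurable P"
    by (rule lborel.borel_measurable_lebesgue_integral) (simp add: case_prod_unfold)
  moreover have "conga_line \<alpha> (\<lambda>s. X s \<omega>) t x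
      = (\<integral>z. indicator {0..1} z *\<^sub>R conga_kernel \<alpha> t x z *\<^sub>R X (c (1 - z)) \<omega> \<partial>lborel)" for \<omega>
    unfolding conga_line_eq set_lebesgue_integral_def
    by (intro Bochner_Integration.integral_cong refl) (auto simp: c_def indicator_def)
  ultimately show ?thesis by simp
qed

text \<open>The dominating constant for continuity in \<open>x\<close>. As \<open>z\<close> tends to 0 the kernel has the singular factor
  \<open>z powr (-3/2)\<close>, but \<open>x \<ge> a > 0\<close> makes the exponential at most \<open>exp q * exp (- p / z)\<close>, which is \<open>O(z\<^sup>2)\<close>.\<close>

lemma conga_kernel_bounded:
  assumes "0 < \<alpha>" "\<alpha> < 1" "0 < t" "0 < a"
  obtains C where "\<And>x z. x \<in> {a..b} \<Longrightarrow> z \<in> {0..1} \<Longrightarrow> \<bar>conga_kernel \<alpha> t x z\<bar> \<le> C"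
proof
  let ?s = "conga_sigma \<alpha> t"
  define p where "p = a\<^sup>2 / (2 * ?s\<^sup>2)"
  define q where "q = \<alpha> * b / ?s\<^sup>2"
  define C where "C = (b + 1) / (2 * ?s) * (exp q * (2 / p\<^sup>2))"
  have s: "0 < ?s" using conga_sigma_pos assms by blast
  have p: "0 < p" using s assms by (simp add: p_def)
  fix x z assume x: "x \<in> {a..b}" and z: "z \<in> {0..1::real}"
  have "0 < b" using x assms by auto
  hence C0: "0 \<le> C" using s by (simp add: C_def)
  show "\<bar>conga_kernel \<alpha> t x z\<bar> \<le> C"
  proof (cases "z = 0")
    case True thus ?thesis using C0 by (simp add: conga_kernel_def)
  next
    case False
    hence z0: "0 < z" "z \<le> 1" using z by auto
    have "p / z - q \<le> (x - \<alpha> * z)\<^sup>2 / (2 * ?s\<^sup>2 * z)"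
    proof -
      have square: "(x - \<alpha> * z)\<^sup>2 = x\<^sup>2 - 2 * (\<alpha> * x * z) + (\<alpha> * z)\<^sup>2"
        by (simp add: power2_eq_square algebra_simps)
      have "a\<^sup>2 \<le> x\<^sup>2" using x assms by (intro power_mono) auto
      moreover have "\<alpha> * x * z \<le> \<alpha> * b * z" using x z0 assms by simp
      ultimately have "a\<^sup>2 - 2 * (\<alpha> * b * z) \<le> (x - \<alpha> * z)\<^sup>2"
        using zero_le_power2[of "\<alpha> * z"] square by linarith
      moreover have "p / z - q = (a\<^sup>2 - 2 * (\<alpha> * b * z)) / (2 * ?s\<^sup>2 * z)"
        using s z0 by (simp add: p_def q_def field_simps)
      ultimately show ?thesis using s z0 by (simp add: divide_right_mono)
    qed
    hence "exp (- ((x - \<alpha> * z)\<^sup>2 / (2 * ?s\<^sup>2 * z))) \<le> exp q * exp (- (p / z))"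
      by (simp flip: exp_add)
    also have "exp (- (p / z)) \<le> 2 * z\<^sup>2 / p\<^sup>2"
    proof -
      have "(p / z)\<^sup>2 / 2 \<le> 1 + p / z + (p / z)\<^sup>2 / 2" using p z0 by simp
      also have "\<dots> \<le> exp (p / z)" using p z0 by (intro exp_lower_Taylor_quadratic) simp
      finally have "inverse (exp (p / z)) \<le> inverse ((p / z)\<^sup>2 / 2)"
        using p z0 by (intro le_imp_inverse_le) auto
      thus ?thesis using p z0 by (simp add: exp_minus power_divide mult.commute)
    qed
    finally have e: "exp (- ((x - \<alpha> * z)\<^sup>2 / (2 * ?s\<^sup>2 * z))) \<le> exp q * (2 * z\<^sup>2 / p\<^sup>2)" by simp
    have "1 \<le> sqrt (2 * pi)" using pi_gt3 by simp
    hence "1 / sqrt (2 * pi) \<le> 1" by simp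
    moreover have "(x + \<alpha> * z) \<le> b + 1"
      using x z0 assms mult_mono[of \<alpha> 1 z 1] by auto
    ultimately have "1 / sqrt (2 * pi) * ((x + \<alpha> * z) / (2 * ?s * z powr (3/2)))
        \<le> 1 * ((b + 1) / (2 * ?s * z powr (3/2)))"
      using s x z0 assms by (intro mult_mono divide_right_mono) auto
    hence "conga_kernel \<alpha> t x z
        \<le> 1 * ((b + 1) / (2 * ?s * z powr (3/2))) * (exp q * (2 * z\<^sup>2 / p\<^sup>2))"
      unfolding conga_kernel_def using e s \<open>0 < b\<close> by (elim mult_mono) auto
    also have "\<dots> = C * (z\<^sup>2 / z powr (3/2))"
      by (simp only: C_def divide_inverse inverse_mult_distrib mult_1_left mult_ac)
    also have "z\<^sup>2 / z powr (3/2) = sqrt z"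
      using z0 real_sqrt_mult_self[of z]
      by (simp add: powr_three_halves power2_eq_square field_simps del: real_sqrt_mult_self)
    also have "C * sqrt z \<le> C" using C0 z0 mult_left_mono[of "sqrt z" 1 C] by simp
    finally show ?thesis using conga_kernel_nonneg[of \<alpha> t x z] x z0 assms by simp
  qed
qed

lemma conga_line_continuous:
  fixes w :: "real \<Rightarrow> real ^ 'd::finite"
  assumes \<alpha>: "0 < \<alpha>" "\<alpha> < 1" and t: "0 < t" and a: "0 < a" and cont: "continuous_on {0..1} w"
  shows "continuous_on {a..b} (conga_line \<alpha> w t)"
proof (rule continuous_on_sequentiallyI)
  fix u :: "nat \<Rightarrow> real" and x
  assume u: "\<forall>n. u n \<in> {a..b}" and x: "x \<in> {a..b}" and lim: "u \<longlonglongrightarrow> x"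
  obtain C where C: "\<And>x z. x \<in> {a..b} \<Longrightarrow> z \<in> {0..1} \<Longrightarrow> \<bar>conga_kernel \<alpha> t x z\<bar> \<le> C"
    using conga_kernel_bounded[OF \<alpha> t a] by blast
  have "bounded (w ` {0..1})"
    using cont compact_continuous_image compact_imp_bounded compact_Icc by blast
  then obtain B where B: "\<And>s. s \<in> {0..1} \<Longrightarrow> norm (w s) \<le> B"
    unfolding bounded_iff by blast
  define e where "e z = w (max 0 (min 1 (1 - z)))" for z
  have "continuous_on UNIV e"
    unfolding e_def by (intro continuous_on_compose2[OF cont] continuous_intros) auto
  hence [measurable]: "e \<in> borel_measurable borel" by (rule borel_measurable_continuous_onI)
  have eq: "conga_line \<alpha> w t y = (\<integral>z. indicator {0..1} z *\<^sub>R conga_kernel \<alpha> t y z *\<^sub>R e z \<partial>lborel)" for y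
    unfolding conga_line_eq set_lebesgue_integral_def
    by (intro Bochner_Integration.integral_cong refl) (auto simp: e_def indicator_def)
  have ker: "(\<lambda>n. conga_kernel \<alpha> t (u n) z) \<longlonglongrightarrow> conga_kernel \<alpha> t x z" for z
  proof (cases "2 * conga_sigma \<alpha> t * z powr (3/2) = 0 \<or> 2 * (conga_sigma \<alpha> t)\<^sup>2 * z = 0")
    case True thus ?thesis using conga_sigma_pos[OF \<alpha> t] by (auto simp: conga_kernel_def)
  next
    case False thus ?thesis unfolding conga_kernel_def by (intro tendsto_intros lim) auto
  qed
  show "(\<lambda>n. conga_line \<alpha> w t (u n)) \<longlonglongrightarrow> conga_line \<alpha> w t x"
    unfolding eq
  proof (rule integral_dominated_convergence[where w = "\<lambda>z. indicator {0..1} z * (C * B)"])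
    show "integrable lborel (\<lambda>z. indicator {0..1::real} z * (C * B))"
      by (intro integrable_mult_left) simp
    show "AE z in lborel. (\<lambda>n. indicator {0..1} z *\<^sub>R conga_kernel \<alpha> t (u n) z *\<^sub>R e z)
        \<longlonglongrightarrow> indicator {0..1} z *\<^sub>R conga_kernel \<alpha> t x z *\<^sub>R e z"
      by (intro AE_I2 tendsto_intros ker)
    show "AE z in lborel. norm (indicator {0..1} z *\<^sub>R conga_kernel \<alpha> t (u n) z *\<^sub>R e z)
        \<le> indicator {0..1} z * (C * B)" for n
    proof (intro AE_I2)
      fix z
      show "norm (indicator {0..1} z *\<^sub>R conga_kernel \<alpha> t (u n) z *\<^sub>R e z) \<le> indicator {0..1} z * (C * B)"
      proof (cases "z \<in> {0..1}")
        case True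
        have "\<bar>conga_kernel \<alpha> t (u n) z\<bar> * norm (e z) \<le> C * B"
          using C[of "u n" z] u True B[of "max 0 (min 1 (1 - z))"] unfolding e_def
          by (intro mult_mono) (auto intro: order_trans[OF abs_ge_zero])
        thus ?thesis using True by simp
      qed simp
    qed
  qed measurable
qed

text \<open>By continuity, a positive value anywhere on \<open>S\<close> forces one on a countable dense subset.\<close>

lemma sets_exists_continuous:
  fixes f :: "'a::{metric_space, second_countable_topology} \<Rightarrow> 'w \<Rightarrow> real"
  assumes meas: "\<And>x. x \<in> S \<Longrightarrow> f x \<in> borel_measurable P"
    and cont: "\<And>\<omega>. \<omega> \<in> space P \<Longrightarrow> continuous_on S (\<lambda>x. f x \<omega>)"
  shows "{\<omega> \<in> space P. \<exists>x\<in>S. f x \<omega> > 0} \<in> sets P"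
proof -
  obtain T where T: "countable T" "T \<subseteq> S" "S \<subseteq> closure T" using separable by blast
  have "(\<exists>x\<in>S. f x \<omega> > 0) \<longleftrightarrow> (\<exists>x\<in>T. f x \<omega> > 0)" if "\<omega> \<in> space P" for \<omega>
  proof
    assume "\<exists>x\<in>S. f x \<omega> > 0"
    then obtain x where x: "x \<in> S" "f x \<omega> > 0" by blast
    have "x \<in> closure T" using x(1) T(3) by blast
    then obtain u where u: "\<And>n. u n \<in> T" "u \<longlonglongrightarrow> x" unfolding closure_sequential by blast
    have "(\<lambda>n. f (u n) \<omega>) \<longlonglongrightarrow> f x \<omega>"
      by (rule continuous_on_tendsto_compose[OF cont[OF that] u(2) x(1)]) (intro always_eventually allI, use u(1) T(2) in blast)
    hence "\<forall>\<^sub>F n in sequentially. f (u n) \<omega> > 0" using x(2) by (rule order_tendstoD)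
    then obtain n where "f (u n) \<omega> > 0" using eventually_happens'[OF sequentially_bot] by blast
    thus "\<exists>x\<in>T. f x \<omega> > 0" using u(1) by blast
  qed (use T in blast)
  hence "{\<omega> \<in> space P. \<exists>x\<in>S. f x \<omega> > 0} = (\<Union>x\<in>T. {\<omega> \<in> space P. f x \<omega> > 0})" by auto
  also have "\<dots> \<in> sets P"
  proof (intro sets.countable_UN'' T(1))
    fix x assume "x \<in> T"
    hence [measurable]: "f x \<in> borel_measurable P" using meas T by blast
    show "{\<omega> \<in> space P. f x \<omega> > 0} \<in> sets P" by measurable
  qed
  finally show ?thesis .
qed

lemma bm_almost_every_path:
  fixes W :: "real \<Rightarrow> 'w \<Rightarrow> real ^ 'd::finite"
  assumes "std_brownian_motion P W"
  shows "AE \<omega> in P. continuous_on {0..1} (\<lambda>s. W s \<omega>) \<and> W 0 \<omega> = 0"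
proof -
  have "AE \<omega> in P. \<forall>i. continuous_on {0..1} (\<lambda>s. W s \<omega> $ i) \<and> W 0 \<omega> $ i = 0"
    unfolding AE_all_countable
    using assms by (simp add: std_brownian_motion_def std_brownian_motion_1d_def)
  thus ?thesis
  proof eventually_elim
    case (elim \<omega>)
    have "continuous_on {0..1} (\<lambda>s. \<chi> i. W s \<omega> $ i)" using elim by (intro continuous_on_vec_lambda) auto
    thus ?case using elim by (simp add: vec_eq_iff)
  qed
qed

lemma bm_measurable:
  fixes W :: "real \<Rightarrow> 'w \<Rightarrow> real ^ 'd::finite"
  assumes "std_brownian_motion P W" and "s \<in> {0..1}"
  shows "W s \<in> borel_measurable P"
proof (rule iffD2[OF borel_measurable_euclidean_space], rule ballI)
  fix b :: "real ^ 'd" assume "b \<in> Basis"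
  then obtain i where "b = axis i 1" by (auto simp: Basis_vec_def)
  moreover have "(\<lambda>\<omega>. W s \<omega> $ i) \<in> borel_measurable P"
    using assms by (simp add: std_brownian_motion_def std_brownian_motion_1d_def)
  ultimately show "(\<lambda>\<omega>. W s \<omega> \<bullet> b) \<in> borel_measurable P" by (simp add: inner_axis)
qed

text \<open>Replacing the discontinuous paths by the zero path changes the event only inside a null set, and for
  the modified process it is measurable.\<close>

lemma conga_deviation_event_sets:
  fixes W :: "real \<Rightarrow> 'w \<Rightarrow> real ^ 'd::finite"
  assumes bm: "std_brownian_motion P W" and \<alpha>: "0 < \<alpha>" "\<alpha> < 1" and t: "0 < t" and a: "0 < a"
  shows "{\<omega> \<in> space P. \<exists>x\<in>{a..\<alpha>}.
      norm (conga_line \<alpha> (\<lambda>s. W s \<omega>) t x - W (1 - x / \<alpha>) \<omega>) > \<kappa> * conga_rate t x} \<in> sets (completion P)"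
    (is "?E \<in> _")
proof -
  obtain N where N: "{\<omega> \<in> space P. \<not> (continuous_on {0..1} (\<lambda>s. W s \<omega>) \<and> W 0 \<omega> = 0)} \<subseteq> N"
    and "emeasure P N = 0" "N \<in> sets P"
    by (rule AE_E[OF bm_almost_every_path[OF bm]])
  hence null: "N \<in> null_sets P" by (simp add: null_setsI)
  define X where "X s \<omega> = (if \<omega> \<in> N then 0 else W s \<omega>)" for s \<omega>
  define dev where "dev x \<omega> = norm (conga_line \<alpha> (\<lambda>s. X s \<omega>) t x - X (1 - x / \<alpha>) \<omega>) - \<kappa> * conga_rate t x" for x \<omega>
  have [measurable]: "N \<in> sets P" by fact
  have in01: "1 - x / \<alpha> \<in> {0..1}" if "x \<in> {a..\<alpha>}" for x using that a \<alpha> by (auto simp: divide_le_eq)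
  have X_meas: "X s \<in> borel_measurable P" if "s \<in> {0..1}" for s
  proof -
    have [measurable]: "W s \<in> borel_measurable P" using bm_measurable[OF bm that] .
    show ?thesis unfolding X_def by measurable
  qed
  have X_cont: "continuous_on {0..1} (\<lambda>s. X s \<omega>)" if "\<omega> \<in> space P" for \<omega>
    using N that by (cases "\<omega> \<in> N") (auto simp: X_def)
  have "{\<omega> \<in> space P. \<exists>x\<in>{a..\<alpha>}. dev x \<omega> > 0} \<in> sets P"
  proof (rule sets_exists_continuous)
    fix x assume x: "x \<in> {a..\<alpha>}"
    have [measurable]: "X (1 - x / \<alpha>) \<in> borel_measurable P"
      "(\<lambda>\<omega>. conga_line \<alpha> (\<lambda>s. X s \<omega>) t x) \<in> borel_measurable P"
      using X_meas[OF in01[OF x]] conga_line_measurable[OF X_meas X_cont] by auto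
    show "dev x \<in> borel_measurable P" unfolding dev_def by measurable
  next
    fix \<omega> assume \<omega>: "\<omega> \<in> space P"
    have "continuous_on {a..\<alpha>} (\<lambda>x. X (1 - x / \<alpha>) \<omega>)"
      using in01 \<alpha> by (intro continuous_on_compose2[OF X_cont[OF \<omega>]] continuous_intros) auto
    moreover have "continuous_on {a..\<alpha>} (conga_rate t)"
      unfolding conga_rate_def using a t by (intro continuous_intros) auto
    ultimately show "continuous_on {a..\<alpha>} (\<lambda>x. dev x \<omega>)"
      unfolding dev_def by (intro continuous_intros conga_line_continuous[OF \<alpha> t a X_cont[OF \<omega>]])
  qed
  hence "{\<omega> \<in> space P. \<exists>x\<in>{a..\<alpha>}. dev x \<omega> > 0} - N \<in> sets P" by measurable
  moreover have "?E = ({\<omega> \<in> space P. \<exists>x\<in>{a..\<alpha>}. dev x \<omega> > 0} - N) \<union> (?E \<inter> N)"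
    by (auto simp: dev_def X_def)
  ultimately show ?thesis by (intro sets_completionI[OF _ _ null]) auto
qed

section \<open>Rate of convergence\<close>

theorem theorem6:
  fixes P :: "'w measure" and W :: "real \<Rightarrow> 'w \<Rightarrow> real ^ 2" and \<alpha> M :: real
  assumes "prob_space P"
    and "std_brownian_motion P W"
    and "0 < \<alpha>" and "\<alpha> < 1"
    and "M > 2"
  shows "\<exists>\<kappa> :: real.
     (AE \<omega> in P. \<exists>T>0. \<forall>t\<ge>T. \<forall>x\<in>{0<..\<alpha>}. x > \<alpha> * conga_L \<alpha> M t x \<longrightarrow>
        norm (conga_line \<alpha> (\<lambda>s. W s \<omega>) t x - W (1 - x / \<alpha>) \<omega>) \<le> \<kappa> * conga_rate t x) \<and>
     (\<forall>\<beta>\<in>{0<..<1}.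
        (AE \<omega> in P. \<exists>T>0. \<forall>t\<ge>T. \<forall>x\<in>{t powr (- \<beta>)..\<alpha>}.
           norm (conga_line \<alpha> (\<lambda>s. W s \<omega>) t x - W (1 - x / \<alpha>) \<omega>) \<le> \<kappa> * conga_rate t x) \<and>
        (\<forall>\<^sub>F t in at_top.
           {\<omega> \<in> space P. \<exists>x\<in>{t powr (- \<beta>)..\<alpha>}.
              norm (conga_line \<alpha> (\<lambda>s. W s \<omega>) t x - W (1 - x / \<alpha>) \<omega>) > \<kappa> * conga_rate t x}
             \<in> sets (completion P) \<and>
           measure (completion P) {\<omega> \<in> space P. \<exists>x\<in>{t powr (- \<beta>)..\<alpha>}.
              norm (conga_line \<alpha> (\<lambda>s. W s \<omega>) t x - W (1 - x / \<alpha>) \<omega>) > \<kappa> * conga_rate t x}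
             \<le> t powr (- 2)))"
proof -
  interpret prob_space P by fact
  note bm = \<open>std_brownian_motion P W\<close> and \<alpha> = \<open>0 < \<alpha>\<close> \<open>\<alpha> < 1\<close>
  \<comment> \<open>The common lower bound for \<open>x t\<close> in both regions of \<open>x\<close>.\<close>
  define c where "c = \<alpha> * (1 - \<alpha>)"
  define \<kappa> where "\<kappa> = 300 * real CARD(2) * (1 + (1 + 1 / sqrt c) / \<alpha>\<^sup>2)"
  let ?dev = "\<lambda>\<omega> t x. norm (conga_line \<alpha> (\<lambda>s. W s \<omega>) t x - W (1 - x / \<alpha>) \<omega>)"
  have c: "0 < c" "c \<le> 1" using \<alpha> by (auto simp: c_def mult_le_one)
  have bound: "?dev \<omega> t x \<le> \<kappa> * conga_rate t x"
    if "continuous_on {0..1} (\<lambda>s. W s \<omega>) \<and> W 0 \<omega> = 0" "2 \<le> m" "dyadic_good m (\<lambda>s. W s \<omega>)"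
      "2 ^ m \<le> sqrt t" "0 < x" "x \<le> \<alpha>" "c \<le> x * t" for \<omega> m t x
    using conga_line_bound[OF \<alpha> that(5,6) c(1) that(7,4,2,3)] that(1) by (simp add: \<kappa>_def)
  have strip: "0 < x" "c \<le> x * t" if "x \<in> {t powr (- \<beta>)..\<alpha>}" "\<beta> \<in> {0<..<1}" "1 \<le> t" for x t \<beta> :: real
  proof -
    show "0 < x" using that by (auto intro: less_le_trans[of _ "t powr (- \<beta>)"])
    have "1 \<le> t powr (1 - \<beta>)" using that by (intro ge_one_powr_ge_zero) auto
    also have "\<dots> = t powr (- \<beta>) * t" using that powr_add[of t "- \<beta>" 1] by simp
    also have "\<dots> \<le> x * t" using that by (intro mult_right_mono) auto
    finally show "c \<le> x * t" using c by linarith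
  qed
  have paths: "AE \<omega> in P. (continuous_on {0..1} (\<lambda>s. W s \<omega>) \<and> W 0 \<omega> = 0) \<and>
      (\<exists>m\<ge>2. dyadic_good m (\<lambda>s. W s \<omega>))"
    using bm_almost_every_path[OF bm] bm_eventually_dyadic_good[OF \<open>prob_space P\<close> bm]
    by eventually_elim blast
  have scale: "3 \<le> t" "2 ^ m \<le> sqrt t" if "max 3 ((2 ^ m)\<^sup>2) \<le> t" for t :: real and m
    using that by (auto intro: real_le_rsqrt)
  have region: "AE \<omega> in P. \<exists>T>0. \<forall>t\<ge>T. \<forall>x\<in>{0<..\<alpha>}. x > \<alpha> * conga_L \<alpha> M t x \<longrightarrow>
      ?dev \<omega> t x \<le> \<kappa> * conga_rate t x"
    using paths
  proof eventually_elim
    case (elim \<omega>)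
    then obtain m where m: "2 \<le> m" "dyadic_good m (\<lambda>s. W s \<omega>)" by blast
    show ?case
    proof (intro exI[of _ "max 3 ((2 ^ m)\<^sup>2)"] conjI allI ballI impI)
      fix t x assume t: "max 3 ((2 ^ m)\<^sup>2) \<le> t" and x: "x \<in> {0<..\<alpha>}" and L: "x > \<alpha> * conga_L \<alpha> M t x"
      have "c \<le> x * t"
        unfolding c_def using conga_L_region[OF \<alpha> _ scale(1)[OF t] _ _ L] \<open>M > 2\<close> x by simp
      thus "?dev \<omega> t x \<le> \<kappa> * conga_rate t x"
        using bound[OF _ m scale(2)[OF t]] elim x by simp
    qed simp
  qed
  have strip_ae: "AE \<omega> in P. \<exists>T>0. \<forall>t\<ge>T. \<forall>x\<in>{t powr (- \<beta>)..\<alpha>}. ?dev \<omega> t x \<le> \<kappa> * conga_rate t x"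
    if \<beta>: "\<beta> \<in> {0<..<1}" for \<beta>
    using paths
  proof eventually_elim
    case (elim \<omega>)
    then obtain m where m: "2 \<le> m" "dyadic_good m (\<lambda>s. W s \<omega>)" by blast
    show ?case
    proof (intro exI[of _ "max 3 ((2 ^ m)\<^sup>2)"] conjI allI impI ballI)
      fix t x assume t: "max 3 ((2 ^ m)\<^sup>2) \<le> t" and x: "x \<in> {t powr (- \<beta>)..\<alpha>}"
      show "?dev \<omega> t x \<le> \<kappa> * conga_rate t x"
        using bound[OF _ m scale(2)[OF t]] strip[OF x \<beta>] scale(1)[OF t] elim x by simp
    qed simp
  qed
  have strip_prob: "\<forall>\<^sub>F t in at_top.
      {\<omega> \<in> space P. \<exists>x\<in>{t powr (- \<beta>)..\<alpha>}. ?dev \<omega> t x > \<kappa> * conga_rate t x} \<in> sets (completion P) \<and>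
      measure (completion P) {\<omega> \<in> space P. \<exists>x\<in>{t powr (- \<beta>)..\<alpha>}. ?dev \<omega> t x > \<kappa> * conga_rate t x}
        \<le> t powr (- 2)"
    if \<beta>: "\<beta> \<in> {0<..<1}" for \<beta>
    \<comment> \<open>The failure probability comes out as at most \<open>256 t powr (-5/2)\<close>, hence the threshold \<open>sqrt t \<ge> 256\<close>.\<close>
    using eventually_ge_at_top[of "256\<^sup>2"]
  proof eventually_elim
    fix t :: real assume t: "256\<^sup>2 \<le> t"
    let ?E = "{\<omega> \<in> space P. \<exists>x\<in>{t powr (- \<beta>)..\<alpha>}. ?dev \<omega> t x > \<kappa> * conga_rate t x}"
    have E: "?E \<in> sets (completion P)"
      using conga_deviation_event_sets[OF bm \<alpha>, of t "t powr (- \<beta>)" \<kappa>] t by simp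
    define r where "r = sqrt t"
    have r: "256 \<le> r" "t = r\<^sup>2" using t by (auto simp: r_def intro: real_le_rsqrt)
    \<comment> \<open>The finest usable level, so that \<open>2\<^sup>m \<le> sqrt t < 2\<^sup>m\<^sup>+\<^sup>1\<close>.\<close>
    define m where "m = nat \<lfloor>log 2 r\<rfloor>"
    have "real 2 \<le> log 2 r" using r by (simp add: le_log_iff)
    hence m: "2 \<le> m" "real m \<le> log 2 r" "log 2 r < real m + 1"
      unfolding m_def by (simp_all add: le_nat_floor)
    have rm: "2 ^ m \<le> r" "r < 2 ^ Suc m"
      using m r by (simp_all add: le_log_iff log_less_iff powr_realpow powr_add)
    let ?B = "{\<omega> \<in> space P. \<not> dyadic_good m (\<lambda>s. W s \<omega>)}"
    note bad = bm_dyadic_good_prob[OF \<open>prob_space P\<close> bm, of m]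
    have "AE \<omega> in P. \<omega> \<in> ?E \<longrightarrow> \<omega> \<in> ?B"
      using bm_almost_every_path[OF bm]
    proof eventually_elim
      case (elim \<omega>)
      show ?case
      proof (intro impI CollectI conjI notI)
        assume "\<omega> \<in> ?E" and good: "dyadic_good m (\<lambda>s. W s \<omega>)"
        then obtain x where x: "x \<in> {t powr (- \<beta>)..\<alpha>}" "\<kappa> * conga_rate t x < ?dev \<omega> t x" by blast
        have "?dev \<omega> t x \<le> \<kappa> * conga_rate t x"
          using bound[OF elim m(1) good, of t x] strip[OF x(1) \<beta>] rm(1) t x(1) by (simp add: r_def)
        thus False using x(2) by linarith
      qed simp
    qed
    hence "measure (completion P) ?E \<le> measure (completion P) ?B"
      using E bad(1) prob_space.finite_measure[OF prob_space_completion]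
      by (intro finite_measure.finite_measure_mono_AE) (auto simp: AE_completion)
    also have "\<dots> \<le> 8 / 32 ^ m" using bad by simp
    also have "(32::real) ^ m = (2 ^ m) ^ 5"
      using power_mult[of "2::real" 5 m] power_mult[of "2::real" m 5] by (simp add: mult.commute)
    also have "8 / (2 ^ m) ^ 5 = 256 / (2 ^ Suc m :: real) ^ 5" by (simp add: power_mult_distrib)
    also have "\<dots> \<le> 256 / r ^ 5" using rm(2) r by (intro divide_left_mono power_mono) auto
    also have "\<dots> \<le> r / r ^ 5" using r by (intro divide_right_mono) auto
    also have "\<dots> = 1 / (r\<^sup>2)\<^sup>2" using r by (simp add: eval_nat_numeral)
    also have "\<dots> = t powr (- 2)" using r by (simp add: powr_minus inverse_eq_divide)
    finally show "?E \<in> sets (completion P) \<and> measure (completion P) ?E \<le> t powr (- 2)" using E by blast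
  qed
  show ?thesis
    by (intro exI[of _ \<kappa>] conjI ballI region strip_ae strip_prob)
qed

end
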